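(* Let $B=(B(u),\,u\ge0)$ be a standard Brownian motion. The process $(V_k^+(t),\,t\ge0)$ satisfies $$\bigl(V_k^+(t),\,t\ge0\bigr)\stackrel{d}{=}\Bigl(B\bigl(K_k^+\,t^{d(k-1)}\bigr),\,t\ge0\Bigr),\qquad K_k^+:=B_k\int_{(\mathbb{R}^d)^{k-1}}h^+(0,\mathbf{y})\,d\mathbf{y}.$$ Likewise $$\bigl(V_k^-(t),\,t\ge0\bigr)\stackrel{d}{=}\Bigl(B\bigl(K_k^-\,t^{d(k-1)}\bigr),\,t\ge0\Bigr),\qquad K_k^-:=B_k\int_{(\mathbb{R}^d)^{k-1}}h^-(0,\mathbf{y})\,d\mathbf{y}.$$
   Context: Fix integers $d\ge1$, $k\ge2$, a real $\alpha>d$, and a connected graph $\Gamma$ with $k$ vertices and $j$ edges. For a finite set $\mathcal{X}\subset\mathbb{R}^d$ and $t\ge0$, $G(\mathcal{X},t)$ is the undirected graph with vertex set $\mathcal{X}$ and an edge between distinct $x,y\in\mathcal{X}$ iff $\|x-y\|\le t$ (Euclidean norm); $\cong$ denotes graph isomorphism. For $x_1,\dots,x_k\in\mathbb{R}^d$: $h_t(x_1,\dots,x_k)=\mathbf{1}\{G(\{x_1,\dots,x_k\},t)\cong\Gamma\}$; $h_t^-(x_1,\dots,x_k)=1$ if $G(\{x_1,\dots,x_k\},t)$ is a connected graph on $k$ vertices with more than $j$ edges, and $0$ otherwise; $h_t^+=h_t+h_t^-$. Write $h^\pm=h_1^\pm$. $B_k=\dfrac{s_{d-1}}{k!\,(\alpha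 k-d)}$ with $s_{d-1}$ the surface area of the unit sphere in $\mathbb{R}^d$. $G_k$ is a Gaussian $B_k\lambda_k$-noise on $(\mathbb{R}^d)^{k-1}$, where $\lambda_k$ is Lebesgue measure on $(\mathbb{R}^d)^{k-1}$ (centered Gaussian random measure with $G_k(A)\sim\mathcal{N}(0,B_k\lambda_k(A))$ when $\lambda_k(A)<\infty$, independent on disjoint sets). Define $V_k^\pm(t)=\int_{(\mathbb{R}^d)^{k-1}}h_t^\pm(0,\mathbf{y})\,G_k(d\mathbf{y})$, $t\ge0$. $\stackrel{d}{=}$ denotes equality of finite-dimensional distributions. *)

theory Defs
  imports "HOL-Probability.Probability" "Graph_Theory.Digraph_Isomorphism" "Graph_Theory.Pair_Digraph"
begin

section \<open>Geometric graphs\<close>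

text \<open>
  Finite simple undirected graphs are rendered as in the AFP entry Graph_Theory, i.e. as finite
  vertex-pair digraphs satisfying \<^locale>\<open>pair_graph\<close> (symmetric arc relation, no loops).
  For these, \<^const>\<open>digraph_iso\<close> is undirected graph isomorphism.  Each undirected edge is a pair of
  opposite arcs, hence the number of edges is counted through unordered pairs.
\<close>

definition num_edges :: "'a pair_pre_digraph \<Rightarrow> nat" where
  "num_edges G = card {{u, v} |u v. (u, v) \<in> parcs G}"

definition geometric_graph :: "'a::metric_space set \<Rightarrow> real \<Rightarrow> 'a pair_pre_digraph" where
  "geometric_graph X t =
     \<lparr>pverts = X, parcs = {(x, y). x \<in> X \<and> y \<in> X \<and> x \<noteq> y \<and> dist x y \<le> t}\<rparr>"

lemma pair_graph_geometric_graph: "finite X \<Longrightarrow> pair_graph (geometric_graph X t)"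
  by unfold_locales
    (auto simp: geometric_graph_def symmetric_def sym_def dist_commute
          intro: finite_subset[of _ "X \<times> X"])

text \<open>
  A tuple \<open>(x\<^sub>1, \<dots>, x\<^sub>k)\<close> is a function on \<open>nat\<close>, of which only the values on \<open>{1..k}\<close> matter.
  The points need not be distinct, so the graph may have fewer than \<open>k\<close> vertices.
\<close>

definition h_iso ::
    "'v pair_pre_digraph \<Rightarrow> nat \<Rightarrow> real \<Rightarrow> (nat \<Rightarrow> 'a::metric_space) \<Rightarrow> real" where
  "h_iso \<Gamma> k t x =
     of_bool (digraph_iso (with_proj (geometric_graph (x ` {1..k}) t)) (with_proj \<Gamma>))"

definition h_minus :: "nat \<Rightarrow> nat \<Rightarrow> real \<Rightarrow> (nat \<Rightarrow> 'a::metric_space) \<Rightarrow> real" where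
  "h_minus k j t x = (let G = geometric_graph (x ` {1..k}) t in
     of_bool (Digraph_Component.connected (with_proj G) \<and> card (pverts G) = k \<and> num_edges G > j))"

definition h_plus ::
    "'v pair_pre_digraph \<Rightarrow> nat \<Rightarrow> nat \<Rightarrow> real \<Rightarrow> (nat \<Rightarrow> 'a::metric_space) \<Rightarrow> real" where
  "h_plus \<Gamma> k j t x = h_iso \<Gamma> k t x + h_minus k j t x"


section \<open>Gaussian noise and the integral with respect to it\<close>

text \<open>The law \<open>N(0, v)\<close>; for \<open>v = 0\<close> it is the point mass at \<open>0\<close>.\<close>

definition centered_normal :: "real \<Rightarrow> real measure" where
  "centered_normal v =
     (if v = 0 then return borel 0 else density lborel (normal_density 0 (sqrt v)))"

text \<open>
  A Gaussian \<open>\<mu>\<close>-noise is indexed by the measurable sets of finite \<open>\<mu>\<close>-measure; its values on other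
  sets are irrelevant.  As usual for random measures of this kind, additivity holds
  almost surely for each given sequence of sets.
\<close>

locale gaussian_noise = prob_space P for P :: "'p measure" +
  fixes \<mu> :: "'b measure" and W :: "'b set \<Rightarrow> 'p \<Rightarrow> real"
  assumes noise_measurable:
      "\<And>A. A \<in> sets \<mu> \<Longrightarrow> emeasure \<mu> A < \<infinity> \<Longrightarrow> W A \<in> borel_measurable P"
    and noise_distr:
      "\<And>A. A \<in> sets \<mu> \<Longrightarrow> emeasure \<mu> A < \<infinity> \<Longrightarrow>
         distr P borel (W A) = centered_normal (measure \<mu> A)"
    and noise_indep:
      "\<And>(A :: nat \<Rightarrow> 'b set) n. (\<And>i. i < n \<Longrightarrow> A i \<in> sets \<mu> \<and> emeasure \<mu> (A i) < \<infinity>) \<Longrightarrow>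
         disjoint_family_on A {..<n} \<Longrightarrow>
         indep_vars (\<lambda>_. borel) (\<lambda>i. W (A i)) {..<n}"
    and noise_additive:
      "\<And>A :: nat \<Rightarrow> 'b set. range A \<subseteq> sets \<mu> \<Longrightarrow> disjoint_family A \<Longrightarrow> emeasure \<mu> (\<Union>i. A i) < \<infinity> \<Longrightarrow>
         AE \<omega> in P. (\<lambda>i. W (A i) \<omega>) sums W (\<Union>i. A i) \<omega>"

text \<open>
  The integral of square integrable deterministic functions, constructed as usual: on simple functions
  with support of finite measure (the library's \<^const>\<open>Bochner_Integration.simple_bochner_integrable\<close>) it is the obvious
  finite sum, and it is extended by \<open>L\<^sup>2\<close>-limits.  The set \<open>{y. s y = 0}\<close>, possibly of
  infinite measure, enters with weight \<open>0\<close>.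
\<close>

definition simple_noise_integral ::
    "'b measure \<Rightarrow> ('b set \<Rightarrow> 'p \<Rightarrow> real) \<Rightarrow> ('b \<Rightarrow> real) \<Rightarrow> 'p \<Rightarrow> real" where
  "simple_noise_integral \<mu> W s \<omega> = (\<Sum>c\<in>s ` space \<mu>. c * W {y \<in> space \<mu>. s y = c} \<omega>)"

definition has_noise_integral ::
    "'p measure \<Rightarrow> 'b measure \<Rightarrow> ('b set \<Rightarrow> 'p \<Rightarrow> real) \<Rightarrow> ('b \<Rightarrow> real) \<Rightarrow> ('p \<Rightarrow> real) \<Rightarrow> bool" where
  "has_noise_integral P \<mu> W f Z \<longleftrightarrow>
     f \<in> borel_measurable \<mu> \<and> Z \<in> borel_measurable P \<and>
     (\<exists>s :: nat \<Rightarrow> 'b \<Rightarrow> real.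
        (\<forall>n. Bochner_Integration.simple_bochner_integrable \<mu> (s n)) \<and>
        (\<lambda>n. \<integral>\<^sup>+y. ennreal ((s n y - f y)\<^sup>2) \<partial>\<mu>) \<longlonglongrightarrow> 0 \<and>
        (\<lambda>n. \<integral>\<^sup>+\<omega>. ennreal ((simple_noise_integral \<mu> W (s n) \<omega> - Z \<omega>)\<^sup>2) \<partial>P) \<longlonglongrightarrow> 0)"

text \<open>The integral is unique only up to almost sure equality; an arbitrary version is chosen.\<close>

definition noise_integral ::
    "'p measure \<Rightarrow> 'b measure \<Rightarrow> ('b set \<Rightarrow> 'p \<Rightarrow> real) \<Rightarrow> ('b \<Rightarrow> real) \<Rightarrow> 'p \<Rightarrow> real" where
  "noise_integral P \<mu> W f = (SOME Z. has_noise_integral P \<mu> W f Z)"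


section \<open>Brownian motion and finite-dimensional distributions\<close>

locale standard_brownian_motion = prob_space N for N :: "'q measure" +
  fixes B :: "real \<Rightarrow> 'q \<Rightarrow> real"
  assumes bm_measurable: "\<And>u. 0 \<le> u \<Longrightarrow> B u \<in> borel_measurable N"
    and bm_zero: "AE \<omega> in N. B 0 \<omega> = 0"
    and bm_increments:
      "\<And>u v. 0 \<le> u \<Longrightarrow> u < v \<Longrightarrow> distr N borel (\<lambda>\<omega>. B v \<omega> - B u \<omega>) = centered_normal (v - u)"
    and bm_indep:
      "\<And>(u :: nat \<Rightarrow> real) n. 0 \<le> u 0 \<Longrightarrow> (\<And>i. i < n \<Longrightarrow> u i < u (Suc i)) \<Longrightarrow>
         indep_vars (\<lambda>_. borel) (\<lambda>i \<omega>. B (u (Suc i)) \<omega> - B (u i) \<omega>) {..<n}"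
    and bm_continuous: "AE \<omega> in N. continuous_on {0..} (\<lambda>u. B u \<omega>)"

definition eq_fdd ::
    "'t set \<Rightarrow> 'p measure \<Rightarrow> ('t \<Rightarrow> 'p \<Rightarrow> real) \<Rightarrow> 'q measure \<Rightarrow> ('t \<Rightarrow> 'q \<Rightarrow> real) \<Rightarrow> bool" where
  "eq_fdd T P X N Y \<longleftrightarrow>
     (\<forall>t\<in>T. X t \<in> borel_measurable P \<and> Y t \<in> borel_measurable N) \<and>
     (\<forall>J. finite J \<and> J \<subseteq> T \<longrightarrow>
        distr P (PiM J (\<lambda>_. borel)) (\<lambda>\<omega>. \<lambda>t\<in>J. X t \<omega>) =
        distr N (PiM J (\<lambda>_. borel)) (\<lambda>\<omega>. \<lambda>t\<in>J. Y t \<omega>))"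


section \<open>The constants and the processes\<close>

text \<open>
  Surface area of a compact hypersurface as its (two-sided) Minkowski content.
\<close>

definition surface_area :: "'a::euclidean_space set \<Rightarrow> real" where
  "surface_area S =
     Lim (at_right 0) (\<lambda>\<epsilon>. measure lborel {x. infdist x S \<le> \<epsilon>} / (2 * \<epsilon>))"

lemma infdist_unit_sphere:
  "infdist x (sphere (0::'a::euclidean_space) 1) = \<bar>norm x - 1\<bar>"
proof (rule antisym)
  obtain b :: 'a where b: "norm b = 1"
    using nonempty_Basis norm_Basis by blast
  define y where "y = (if x = 0 then b else x /\<^sub>R norm x)"
  have y: "y \<in> sphere 0 1"
    using b by (auto simp: y_def)
  have "dist x y = \<bar>norm x - 1\<bar>"
  proof (cases "x = 0")
    case False
    have "x - x /\<^sub>R norm x = (1 - 1 / norm x) *\<^sub>R x"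
      by (simp add: algebra_simps divide_inverse)
    then have "dist x y = \<bar>1 - 1 / norm x\<bar> * norm x"
      using False by (simp add: y_def dist_norm)
    also have "\<dots> = \<bar>(1 - 1 / norm x) * norm x\<bar>"
      by (simp add: abs_mult)
    also have "(1 - 1 / norm x) * norm x = norm x - 1"
      using False by (simp add: field_simps)
    finally show ?thesis .
  qed (use b in \<open>simp add: y_def\<close>)
  then show "infdist x (sphere 0 1) \<le> \<bar>norm x - 1\<bar>"
    using infdist_le[OF y, of x] by simp
next
  have "sphere (0::'a) 1 \<noteq> {}" by simp
  then show "\<bar>norm x - 1\<bar> \<le> infdist x (sphere 0 1)"
    unfolding infdist_def
    by (auto intro!: cINF_greatest simp: dist_norm) (metis norm_triangle_ineq3)
qed

text \<open>Agreement with the classical formula, including the value \<open>2\<close> in dimension one.\<close>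

lemma surface_area_unit_sphere:
  "surface_area (sphere (0::'a::euclidean_space) 1) =
     2 * pi powr (real DIM('a) / 2) / Gamma (real DIM('a) / 2)"
proof -
  define n where "n = DIM('a)"
  have n: "n > 0" by (simp add: n_def)
  define v where "v = unit_ball_vol (real n)"
  define g where "g = (\<lambda>r::real. v * ((1 + r) ^ n - (1 - r) ^ n))"
  have vol: "measure lborel {x::'a. infdist x (sphere 0 1) \<le> e} / (2 * e) = g e / (2 * e)"
    if "e \<in> {0<..<1}" for e :: real
  proof -
    have "{x::'a. infdist x (sphere 0 1) \<le> e} = cball 0 (1 + e) - ball 0 (1 - e)"
      by (auto simp: infdist_unit_sphere)
    moreover have "measure lborel (cball 0 (1 + e) - ball 0 (1 - e) :: 'a set) =
        measure lborel (cball 0 (1 + e) :: 'a set) - measure lborel (ball 0 (1 - e) :: 'a set)"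
      using that by (intro measure_Diff) (auto simp: less_imp_neq[OF emeasure_bounded_finite[OF bounded_cball], simplified])
    ultimately show ?thesis
      using that by (simp add: g_def v_def n_def content_cball content_ball algebra_simps)
  qed
  have "(g has_real_derivative 2 * (v * n)) (at 0)"
    unfolding g_def by (auto intro!: derivative_eq_intros simp: algebra_simps)
  then have "((\<lambda>e. g e / e) \<longlongrightarrow> 2 * (v * n)) (at 0)"
    by (simp add: DERIV_def g_def)
  then have "((\<lambda>e. g e / e) \<longlongrightarrow> 2 * (v * n)) (at_right 0)"
    by (rule tendsto_within_subset) simp
  from tendsto_divide[OF this tendsto_const[of 2]]
  have "((\<lambda>e. g e / (2 * e)) \<longlongrightarrow> v * n) (at_right 0)"
    by (simp add: mult.commute)
  moreover have "eventually (\<lambda>e. g e / (2 * e) =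
      measure lborel {x::'a. infdist x (sphere 0 1) \<le> e} / (2 * e)) (at_right 0)"
    using eventually_at_right_real[of 0 1] by (rule eventually_mono) (simp_all only: vol zero_less_one)
  ultimately have "((\<lambda>e. measure lborel {x::'a. infdist x (sphere 0 1) \<le> e} / (2 * e))
      \<longlongrightarrow> v * n) (at_right 0)"
    by (rule Lim_transform_eventually)
  then have area: "surface_area (sphere (0::'a) 1) = v * n"
    unfolding surface_area_def by (intro tendsto_Lim) auto
  have Gam: "Gamma (real n / 2 + 1) = real n / 2 * Gamma (real n / 2)"
    using n by (intro Gamma_plus1) (auto elim!: nonpos_Ints_cases)
  have "v * n = 2 * pi powr (n / 2) / Gamma (n / 2)"
    using n unfolding v_def unit_ball_vol_def Gam by simp
  with area show ?thesis by (simp add: n_def)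
qed

text \<open>
  The space \<open>\<real>\<^sup>d\<close> is \<^typ>\<open>real ^ 'd\<close>, and \<open>(\<real>\<^sup>d)\<^sup>k\<^sup>-\<^sup>1\<close> is the product space over the index set
  \<open>{2..k}\<close>: a point \<open>y\<close> holds the coordinates \<open>x\<^sub>2, \<dots>, x\<^sub>k\<close>, and \<open>(0, y)\<close> is \<open>y(1 := 0)\<close>.
\<close>

definition lambda_k :: "nat \<Rightarrow> (nat \<Rightarrow> real ^ 'd::finite) measure" where
  "lambda_k k = PiM {2..k} (\<lambda>_. lborel)"

definition B_const :: "'d::finite itself \<Rightarrow> real \<Rightarrow> nat \<Rightarrow> real" where
  "B_const _ \<alpha> k =
     surface_area (sphere (0 :: real ^ 'd) 1) / (fact k * (\<alpha> * real k - real CARD('d)))"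

definition noise_control :: "real \<Rightarrow> nat \<Rightarrow> (nat \<Rightarrow> real ^ 'd::finite) measure" where
  "noise_control \<alpha> k = scale_measure (ennreal (B_const TYPE('d) \<alpha> k)) (lambda_k k)"

definition V_plus ::
    "'p measure \<Rightarrow> ((nat \<Rightarrow> real ^ 'd::finite) set \<Rightarrow> 'p \<Rightarrow> real) \<Rightarrow> real \<Rightarrow>
     'v pair_pre_digraph \<Rightarrow> nat \<Rightarrow> nat \<Rightarrow> real \<Rightarrow> 'p \<Rightarrow> real" where
  "V_plus P W \<alpha> \<Gamma> k j t =
     noise_integral P (noise_control \<alpha> k) W (\<lambda>y. h_plus \<Gamma> k j t (y(1 := 0)))"

definition V_minus ::
    "'p measure \<Rightarrow> ((nat \<Rightarrow> real ^ 'd::finite) set \<Rightarrow> 'p \<Rightarrow> real) \<Rightarrow> real \<Rightarrow>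
     nat \<Rightarrow> nat \<Rightarrow> real \<Rightarrow> 'p \<Rightarrow> real" where
  "V_minus P W \<alpha> k j t =
     noise_integral P (noise_control \<alpha> k) W (\<lambda>y. h_minus k j t (y(1 := 0)))"

definition K_plus ::
    "'d::finite itself \<Rightarrow> real \<Rightarrow> 'v pair_pre_digraph \<Rightarrow> nat \<Rightarrow> nat \<Rightarrow> real" where
  "K_plus _ \<alpha> \<Gamma> k j = B_const TYPE('d) \<alpha> k *
     (\<integral>y. h_plus \<Gamma> k j 1 (y(1 := (0 :: real ^ 'd))) \<partial>lambda_k k)"

definition K_minus :: "'d::finite itself \<Rightarrow> real \<Rightarrow> nat \<Rightarrow> nat \<Rightarrow> real" where
  "K_minus _ \<alpha> k j = B_const TYPE('d) \<alpha> k *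
     (\<integral>y. h_minus k j 1 (y(1 := (0 :: real ^ 'd))) \<partial>lambda_k k)"

end

theory Submission
  imports Defs
begin

text \<open>
  Both \<open>h\<^sub>t\<^sup>+\<close> and \<open>h\<^sub>t\<^sup>-\<close> are indicators, so their noise integrals should be noises of sets: with
  \<open>A t\<close> the set of all \<open>y\<close> for which \<open>(0, y)\<close> counts at scale \<open>t\<close>, the process is \<open>t \<mapsto> W (A t)\<close> up to
  null events (\<open>noise_integral_indicator\<close>).  This rests on the isometry of the noise integral,
  which in turn follows from the covariance formula \<open>E (W A * W B) = \<mu> (A \<inter> B)\<close>
  (\<open>noise_covariance\<close>).

  The sets \<open>A t\<close> increase with \<open>t\<close>.  For \<open>h\<^sup>-\<close> this is clear, because adding edges keeps a graph connected
  and does not lower the number of edges.  For \<open>h\<^sup>+\<close> it holds because a copy of \<open>\<Gamma>\<close> that gains an edge passes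
  from the first summand of \<open>h\<^sup>+\<close> to the second.  Hence \<open>t \<mapsto> W (A t)\<close> has independent centered
  Gaussian increments, with variance \<open>\<mu> (A t) - \<mu> (A s)\<close>.

  For distinct points, whether \<open>(0, y)\<close> counts at scale \<open>t\<close> depends only on which pairs of points are within distance \<open>t\<close>.
  Therefore \<open>A t\<close> is, for \<open>t > 0\<close>, the image of \<open>A 1\<close> under dilation by \<open>t\<close>; at \<open>t = 0\<close> distinct points have
  no edges and \<open>A 0\<close> is empty.  Thus \<open>\<mu> (A t) = K * t ^ (d * (k - 1))\<close> with
  \<open>K = \<mu> (A 1)\<close>, which is finite because connected configurations containing \<open>0\<close> are bounded
  (\<open>measure_region\<close>, \<open>region_finite_measure\<close>).  The time-changed Brownian motion has independent
  increments with the same laws, and a process starting at \<open>0\<close> with independent increments has its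
  finite-dimensional distributions determined by the laws of the increments
  (\<open>eq_fdd_independent_increments\<close>).
\<close>

section \<open>Finite-dimensional distributions\<close>

lemma eq_fdd_cong_AE:
  assumes eq: "eq_fdd T P X' N Y'"
    and X: "\<And>t. t \<in> T \<Longrightarrow> X t \<in> borel_measurable P"
    and Y: "\<And>t. t \<in> T \<Longrightarrow> Y t \<in> borel_measurable N"
    and XX': "\<And>t. t \<in> T \<Longrightarrow> AE \<omega> in P. X t \<omega> = X' t \<omega>"
    and YY': "\<And>t. t \<in> T \<Longrightarrow> AE \<omega> in N. Y t \<omega> = Y' t \<omega>"
  shows "eq_fdd T P X N Y"
proof -
  have law: "distr M (PiM J (\<lambda>_. borel)) (\<lambda>\<omega>. \<lambda>t\<in>J. Z t \<omega>) =
      distr M (PiM J (\<lambda>_. borel)) (\<lambda>\<omega>. \<lambda>t\<in>J. Z' t \<omega>)"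
    if "finite J" and [measurable]: "\<And>t. t \<in> J \<Longrightarrow> Z t \<in> borel_measurable M"
      "\<And>t. t \<in> J \<Longrightarrow> Z' t \<in> borel_measurable M"
      and "\<And>t. t \<in> J \<Longrightarrow> AE \<omega> in M. Z t \<omega> = Z' t \<omega>"
    for J and M :: "'x measure" and Z Z' :: "'a \<Rightarrow> 'x \<Rightarrow> real"
  proof (rule distr_cong_AE)
    have "AE \<omega> in M. \<forall>t\<in>J. Z t \<omega> = Z' t \<omega>"
      using that by (intro AE_finite_allI) auto
    then show "AE \<omega> in M. (\<lambda>t\<in>J. Z t \<omega>) = (\<lambda>t\<in>J. Z' t \<omega>)"
      by eventually_elim (auto simp: restrict_def)
  qed (auto intro!: measurable_restrict that)
  show ?thesis
    unfolding eq_fdd_def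
  proof (intro conjI allI impI ballI)
    fix J assume J: "finite J \<and> J \<subseteq> T"
    have "distr P (PiM J (\<lambda>_. borel)) (\<lambda>\<omega>. \<lambda>t\<in>J. X t \<omega>) =
        distr P (PiM J (\<lambda>_. borel)) (\<lambda>\<omega>. \<lambda>t\<in>J. X' t \<omega>)"
      using J X XX' eq by (intro law) (auto simp: eq_fdd_def)
    also have "\<dots> = distr N (PiM J (\<lambda>_. borel)) (\<lambda>\<omega>. \<lambda>t\<in>J. Y' t \<omega>)"
      using J eq by (simp add: eq_fdd_def)
    also have "\<dots> = distr N (PiM J (\<lambda>_. borel)) (\<lambda>\<omega>. \<lambda>t\<in>J. Y t \<omega>)"
      using J Y YY' eq by (intro law[symmetric]) (auto simp: eq_fdd_def)
    finally show "distr P (PiM J (\<lambda>_. borel)) (\<lambda>\<omega>. \<lambda>t\<in>J. X t \<omega>) =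
        distr N (PiM J (\<lambda>_. borel)) (\<lambda>\<omega>. \<lambda>t\<in>J. Y t \<omega>)" .
  qed (use X Y in auto)
qed

lemma eq_fdd_constant:
  assumes "prob_space P" "prob_space N"
  shows "eq_fdd T P (\<lambda>t _. c t) N (\<lambda>t _. c t)"
  using assms by (auto simp: eq_fdd_def prob_space.distr_const space_PiM)

text \<open>
  Increments of a noise agree with noises of set differences only almost surely, so independence has to
  be passed along almost sure equality; it does pass, being a property of the joint law.
\<close>

lemma (in prob_space) indep_vars_cong_AE:
  assumes X: "indep_vars M' X I" and "finite I" "I \<noteq> {}"
    and Y: "\<And>i. i \<in> I \<Longrightarrow> Y i \<in> measurable M (M' i)"
    and eq: "\<And>i. i \<in> I \<Longrightarrow> AE \<omega> in M. X i \<omega> = Y i \<omega>"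
  shows "indep_vars M' Y I"
proof (subst indep_vars_iff_distr_eq_PiM'[OF \<open>I \<noteq> {}\<close> Y])
  have Xm: "X i \<in> measurable M (M' i)" if "i \<in> I" for i
    using X that by (auto simp: indep_vars_def2)
  have "AE \<omega> in M. \<forall>i\<in>I. X i \<omega> = Y i \<omega>"
    using \<open>finite I\<close> eq by (intro AE_finite_allI) auto
  then have "AE \<omega> in M. (\<lambda>i\<in>I. Y i \<omega>) = (\<lambda>i\<in>I. X i \<omega>)"
    by eventually_elim (auto simp: restrict_def)
  then have "distr M (PiM I M') (\<lambda>\<omega>. \<lambda>i\<in>I. Y i \<omega>) = distr M (PiM I M') (\<lambda>\<omega>. \<lambda>i\<in>I. X i \<omega>)"
    using Xm Y by (intro distr_cong_AE) (auto intro!: measurable_restrict)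
  also have "\<dots> = PiM I (\<lambda>i. distr M (M' i) (X i))"
    using indep_vars_iff_distr_eq_PiM'[OF \<open>I \<noteq> {}\<close>, of X M'] Xm X by blast
  also have "\<dots> = PiM I (\<lambda>i. distr M (M' i) (Y i))"
    using Xm Y eq by (intro PiM_cong distr_cong_AE) auto
  finally show "distr M (PiM I M') (\<lambda>\<omega>. \<lambda>i\<in>I. Y i \<omega>) = PiM I (\<lambda>i. distr M (M' i) (Y i))" .
qed

text \<open>
  The times at which a process with independent increments is observed, listed in increasing order
  and starting at \<open>0\<close>.  Listing \<open>1\<close> as well costs nothing and guarantees at least one increment, so
  that the empty product of increments never has to be treated.
\<close>

lemma finite_nonneg_enumeration:
  fixes J :: "real set"
  assumes "finite J" "J \<subseteq> {0..}"
  obtains u :: "nat \<Rightarrow> real" and n m where "n > 0" "u 0 = 0" "\<And>i. i < n \<Longrightarrow> u i < u (Suc i)"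
    "\<And>t. t \<in> J \<Longrightarrow> m t \<le> n \<and> u (m t) = t"
    "\<And>i. i \<le> n \<Longrightarrow> u i \<ge> 0"
proof -
  define xs where "xs = sorted_list_of_set (insert 0 (insert 1 J))"
  have set: "set xs = insert 0 (insert 1 J)"
    unfolding xs_def using assms by (intro set_sorted_list_of_set) simp
  have len: "length xs = card (insert 0 (insert 1 J))"
    unfolding xs_def by (simp del: sorted_list_of_set_insert_remove)
  have "card {0, 1 :: real} \<le> length xs"
    unfolding len using assms by (intro card_mono) auto
  then have len2: "length xs \<ge> 2" by simp
  have less: "xs ! i < xs ! j" if "i < j" "j < length xs" for i j
    using that sorted_wrt_nth_less[of "(<)" xs i j] by (simp add: xs_def)
  have nonneg: "xs ! i \<ge> 0" if "i < length xs" for i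
    using nth_mem[OF that] set assms by auto
  obtain i where i: "i < length xs" "xs ! i = 0"
    using set by (metis in_set_conv_nth insertI1)
  have "i = 0"
    using less[of 0 i] nonneg[of 0] i by force
  have "\<forall>t\<in>J. \<exists>m. m < length xs \<and> xs ! m = t"
    using set by (metis in_set_conv_nth insertCI)
  then obtain m where m: "\<forall>t\<in>J. m t < length xs \<and> xs ! (m t) = t"
    by metis
  show thesis
  proof (rule that[of "length xs - 1" "\<lambda>i. xs ! i" m])
    show "xs ! 0 = 0" using i \<open>i = 0\<close> by simp
    show "m t \<le> length xs - 1 \<and> xs ! m t = t" if "t \<in> J" for t
      using m that by fastforce
  qed (use len2 less nonneg in auto)
qed

text \<open>
  Finite-dimensional distributions see a process started at \<open>0\<close> only through its increments over
  successive times: the value at a time is the sum of the increments before it.  Independence makes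
  the joint law of the increments a product of one-dimensional laws, so it suffices
  to compare increments one at a time.
\<close>

lemma eq_fdd_independent_increments:
  fixes X :: "real \<Rightarrow> 'p \<Rightarrow> real" and Y :: "real \<Rightarrow> 'q \<Rightarrow> real"
  assumes "prob_space P" "prob_space N"
    and X: "\<And>t. t \<ge> 0 \<Longrightarrow> X t \<in> borel_measurable P"
    and Y: "\<And>t. t \<ge> 0 \<Longrightarrow> Y t \<in> borel_measurable N"
    and X0: "AE \<omega> in P. X 0 \<omega> = 0" and Y0: "AE \<omega> in N. Y 0 \<omega> = 0"
    and incr: "\<And>s t. 0 \<le> s \<Longrightarrow> s < t \<Longrightarrow>
      distr P borel (\<lambda>\<omega>. X t \<omega> - X s \<omega>) = distr N borel (\<lambda>\<omega>. Y t \<omega> - Y s \<omega>)"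
    and indep_X: "\<And>(u :: nat \<Rightarrow> real) n. n > 0 \<Longrightarrow> (\<And>i. i < n \<Longrightarrow> u i < u (Suc i)) \<Longrightarrow>
      (\<And>i. i \<le> n \<Longrightarrow> u i \<ge> 0) \<Longrightarrow>
      prob_space.indep_vars P (\<lambda>_. borel) (\<lambda>i \<omega>. X (u (Suc i)) \<omega> - X (u i) \<omega>) {..<n}"
    and indep_Y: "\<And>(u :: nat \<Rightarrow> real) n. n > 0 \<Longrightarrow> (\<And>i. i < n \<Longrightarrow> u i < u (Suc i)) \<Longrightarrow>
      (\<And>i. i \<le> n \<Longrightarrow> u i \<ge> 0) \<Longrightarrow>
      prob_space.indep_vars N (\<lambda>_. borel) (\<lambda>i \<omega>. Y (u (Suc i)) \<omega> - Y (u i) \<omega>) {..<n}"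
  shows "eq_fdd {0..} P X N Y"
  unfolding eq_fdd_def
proof (intro conjI allI impI ballI)
  fix J :: "real set" assume J: "finite J \<and> J \<subseteq> {0..}"
  then obtain u :: "nat \<Rightarrow> real" and n m where n: "n > 0" and u0: "u 0 = 0"
    and u: "\<And>i. i < n \<Longrightarrow> u i < u (Suc i)" and m: "\<And>t. t \<in> J \<Longrightarrow> m t \<le> n \<and> u (m t) = t"
    and u_nonneg: "\<And>i. i \<le> n \<Longrightarrow> u i \<ge> 0"
    using finite_nonneg_enumeration[of J] by metis
  \<comment> \<open>Recovers the values at the times in \<open>J\<close> from the vector of increments.\<close>
  define S where "S = (\<lambda>d :: nat \<Rightarrow> real. \<lambda>t\<in>J. \<Sum>i<m t. d i)"
  have S[measurable]: "S \<in> measurable (PiM {..<n} (\<lambda>_. borel)) (PiM J (\<lambda>_. borel))"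
    unfolding S_def using m
    by (intro measurable_restrict borel_measurable_sum measurable_component_singleton) fastforce
  have law: "distr M (PiM J (\<lambda>_. borel)) (\<lambda>\<omega>. \<lambda>t\<in>J. Z t \<omega>) =
      distr (PiM {..<n} (\<lambda>i. distr M borel (\<lambda>\<omega>. Z (u (Suc i)) \<omega> - Z (u i) \<omega>)))
        (PiM J (\<lambda>_. borel)) S"
    if M: "prob_space M" and Z[measurable]: "\<And>t. t \<ge> 0 \<Longrightarrow> Z t \<in> borel_measurable M"
      and Z0: "AE \<omega> in M. Z 0 \<omega> = 0"
      and ind: "prob_space.indep_vars M (\<lambda>_. borel) (\<lambda>i \<omega>. Z (u (Suc i)) \<omega> - Z (u i) \<omega>) {..<n}"
    for M :: "'x measure" and Z :: "real \<Rightarrow> 'x \<Rightarrow> real"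
  proof -
    interpret prob_space M by fact
    define D where "D = (\<lambda>i \<omega>. Z (u (Suc i)) \<omega> - Z (u i) \<omega>)"
    have D[measurable]: "D i \<in> borel_measurable M" if "i < n" for i
      using that u_nonneg[of i] u_nonneg[of "Suc i"] by (auto simp: D_def)
    have DD[measurable]: "(\<lambda>\<omega>. \<lambda>i\<in>{..<n}. D i \<omega>) \<in> measurable M (PiM {..<n} (\<lambda>_. borel))"
      by (intro measurable_restrict) simp
    have "AE \<omega> in M. (\<lambda>t\<in>J. Z t \<omega>) = S (\<lambda>i\<in>{..<n}. D i \<omega>)"
      using Z0
    proof eventually_elim
      case (elim \<omega>)
      have "Z t \<omega> = (\<Sum>i<m t. (\<lambda>i\<in>{..<n}. D i \<omega>) i)" if "t \<in> J" for t
      proof -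
        have "(\<Sum>i<m t. (\<lambda>i\<in>{..<n}. D i \<omega>) i) = (\<Sum>i<m t. Z (u (Suc i)) \<omega> - Z (u i) \<omega>)"
          using m[OF that] by (intro sum.cong) (auto simp: D_def)
        also have "\<dots> = Z t \<omega>"
          using m[OF that] elim u0 by (subst sum_lessThan_telescope) simp
        finally show ?thesis by simp
      qed
      then show ?case by (auto simp: S_def restrict_def)
    qed
    then have "distr M (PiM J (\<lambda>_. borel)) (\<lambda>\<omega>. \<lambda>t\<in>J. Z t \<omega>) =
        distr M (PiM J (\<lambda>_. borel)) (\<lambda>\<omega>. S (\<lambda>i\<in>{..<n}. D i \<omega>))"
      using J by (intro distr_cong_AE) (auto intro!: measurable_restrict Z)
    also have "\<dots> = distr (distr M (PiM {..<n} (\<lambda>_. borel)) (\<lambda>\<omega>. \<lambda>i\<in>{..<n}. D i \<omega>)) (PiM J (\<lambda>_. borel)) S"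
      by (subst distr_distr) (auto simp: comp_def)
    also have "distr M (PiM {..<n} (\<lambda>_. borel)) (\<lambda>\<omega>. \<lambda>i\<in>{..<n}. D i \<omega>) =
        PiM {..<n} (\<lambda>i. distr M borel (D i))"
      using indep_vars_iff_distr_eq_PiM'[of "{..<n}" D "\<lambda>_. borel"] n ind
      by (auto simp: D_def[symmetric])
    finally show ?thesis unfolding D_def .
  qed
  have "distr P (PiM J (\<lambda>_. borel)) (\<lambda>\<omega>. \<lambda>t\<in>J. X t \<omega>) =
      distr (PiM {..<n} (\<lambda>i. distr P borel (\<lambda>\<omega>. X (u (Suc i)) \<omega> - X (u i) \<omega>)))
        (PiM J (\<lambda>_. borel)) S"
    using n u u_nonneg by (intro law assms(1) X X0 indep_X) auto
  also have "PiM {..<n} (\<lambda>i. distr P borel (\<lambda>\<omega>. X (u (Suc i)) \<omega> - X (u i) \<omega>)) =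
      PiM {..<n} (\<lambda>i. distr N borel (\<lambda>\<omega>. Y (u (Suc i)) \<omega> - Y (u i) \<omega>))"
    using u u_nonneg by (intro PiM_cong refl incr) auto
  also have "distr \<dots> (PiM J (\<lambda>_. borel)) S = distr N (PiM J (\<lambda>_. borel)) (\<lambda>\<omega>. \<lambda>t\<in>J. Y t \<omega>)"
    using n u u_nonneg by (intro law[symmetric] assms(2) Y Y0 indep_Y) auto
  finally show "distr P (PiM J (\<lambda>_. borel)) (\<lambda>\<omega>. \<lambda>t\<in>J. X t \<omega>) =
      distr N (PiM J (\<lambda>_. borel)) (\<lambda>\<omega>. \<lambda>t\<in>J. Y t \<omega>)" .
qed (use X Y in auto)

section \<open>Gaussian noise: covariance and integrals of indicators\<close>

lemma centered_normal_moments: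
  assumes "v \<ge> 0"
  shows "integrable (centered_normal v) (\<lambda>x. x)" "(\<integral>x. x \<partial>centered_normal v) = 0"
    and "integrable (centered_normal v) (\<lambda>x. x\<^sup>2)" "(\<integral>x. x\<^sup>2 \<partial>centered_normal v) = v"
proof -
  have "integrable (centered_normal v) (\<lambda>x. x) \<and> (\<integral>x. x \<partial>centered_normal v) = 0 \<and>
    integrable (centered_normal v) (\<lambda>x. x\<^sup>2) \<and> (\<integral>x. x\<^sup>2 \<partial>centered_normal v) = v"
  proof (cases "v = 0")
    case True
    interpret prob_space "return borel (0 :: real)" by (rule prob_space_return) simp
    have int: "integrable (return borel 0) f" if "f \<in> borel_measurable borel" for f :: "real \<Rightarrow> real"
    proof (rule integrable_cong_AE_imp)
      show "AE x in return borel 0. f 0 = f x"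
        using that by (subst AE_return) auto
    qed (use that in auto)
    have cn: "centered_normal v = return borel 0"
      using True by (simp add: centered_normal_def)
    show ?thesis
      unfolding cn using True by (intro conjI int) (simp_all add: integral_return)
  next
    case False
    then have pos: "sqrt v > 0" using assms by simp
    have m1: "has_bochner_integral lborel (\<lambda>x. normal_density 0 (sqrt v) x * x) 0"
      using normal_moment_nz_1[OF pos, of 0] by simp
    have m2: "has_bochner_integral lborel (\<lambda>x. normal_density 0 (sqrt v) x * x\<^sup>2) v"
      using normal_moment_even[OF pos, of 0 1] assms by (simp add: fact_numeral)
    show ?thesis
      using m1 m2 False
      by (auto simp: centered_normal_def integrable_density integral_density has_bochner_integral_iff)
  qed
  then show "integrable (centered_normal v) (\<lambda>x. x)" "(\<integral>x. x \<partial>centered_normal v) = 0"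
    "integrable (centered_normal v) (\<lambda>x. x\<^sup>2)" "(\<integral>x. x\<^sup>2 \<partial>centered_normal v) = v"
    by auto
qed

context gaussian_noise
begin

definition finite_sets :: "'b set set" where
  "finite_sets = {A \<in> sets \<mu>. emeasure \<mu> A < \<infinity>}"

lemma finite_sets_intros [intro]:
  "{} \<in> finite_sets"
  "A \<in> finite_sets \<Longrightarrow> B \<in> finite_sets \<Longrightarrow> A \<union> B \<in> finite_sets"
  "A \<in> finite_sets \<Longrightarrow> B \<in> finite_sets \<Longrightarrow> A \<inter> B \<in> finite_sets"
  "A \<in> finite_sets \<Longrightarrow> B \<in> finite_sets \<Longrightarrow> A - B \<in> finite_sets"
proof -
  show "A \<union> B \<in> finite_sets" if "A \<in> finite_sets" "B \<in> finite_sets"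
    using that emeasure_subadditive[of A \<mu> B]
    by (auto simp: finite_sets_def intro: le_less_trans)
  show "A \<inter> B \<in> finite_sets" if "A \<in> finite_sets" "B \<in> finite_sets"
    using that emeasure_mono[of "A \<inter> B" A \<mu>]
    by (auto simp: finite_sets_def intro: le_less_trans)
  show "A - B \<in> finite_sets" if "A \<in> finite_sets" "B \<in> finite_sets"
    using that emeasure_mono[of "A - B" A \<mu>]
    by (auto simp: finite_sets_def intro: le_less_trans)
qed (auto simp: finite_sets_def)

lemma noise_measurable' [measurable]: "A \<in> finite_sets \<Longrightarrow> W A \<in> borel_measurable P"
  using noise_measurable by (auto simp: finite_sets_def)

lemma noise_distr': "A \<in> finite_sets \<Longrightarrow> distr P borel (W A) = centered_normal (measure \<mu> A)"
  using noise_distr by (auto simp: finite_sets_def)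

lemma noise_null:
  assumes A: "A \<in> finite_sets" "measure \<mu> A = 0"
  shows "AE \<omega> in P. W A \<omega> = 0"
proof -
  have law: "distr P borel (W A) = return borel 0"
    using A by (simp add: noise_distr' centered_normal_def)
  have "AE x in distr P borel (W A). x = 0"
    unfolding law by (subst AE_return) auto
  then show ?thesis
    using A by (subst (asm) AE_distr_iff) auto
qed

text \<open>
  Countable additivity applied to \<open>A, B, {}, {}, \<dots>\<close>: the tail vanishes because the noise of a null
  set is almost surely \<open>0\<close>.
\<close>

lemma noise_Un:
  assumes A: "A \<in> finite_sets" and B: "B \<in> finite_sets" and "A \<inter> B = {}"
  shows "AE \<omega> in P. W (A \<union> B) \<omega> = W A \<omega> + W B \<omega>"
proof -
  have "AE \<omega> in P. (\<lambda>i. W (binaryset A B i) \<omega>) sums W (\<Union>i. binaryset A B i) \<omega>"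
    using assms finite_sets_intros(2)[OF A B] unfolding finite_sets_def
    by (intro noise_additive)
       (auto simp: binaryset_def disjoint_family_on_def UN_binaryset_eq)
  moreover have "AE \<omega> in P. W {} \<omega> = 0"
    by (intro noise_null) auto
  ultimately show ?thesis
  proof eventually_elim
    case (elim \<omega>)
    have "(\<lambda>i. W (binaryset A B i) \<omega>) sums (\<Sum>i<2. W (binaryset A B i) \<omega>)"
      using elim by (intro sums_finite) (auto simp: binaryset_def)
    then have "(\<lambda>i. W (binaryset A B i) \<omega>) sums (W A \<omega> + W B \<omega>)"
      by (simp add: binaryset_def numeral_2_eq_2)
    then show ?case
      using elim sums_unique2 by (metis UN_binaryset_eq)
  qed
qed

lemma noise_Diff:
  assumes A: "A \<in> finite_sets" and B: "B \<in> finite_sets" and "A \<subseteq> B"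
  shows "AE \<omega> in P. W (B - A) \<omega> = W B \<omega> - W A \<omega>"
  using noise_Un[OF A finite_sets_intros(4)[OF B A]] \<open>A \<subseteq> B\<close>
  by (auto simp: Un_absorb1 Un_Diff_cancel)

lemma noise_moments:
  assumes A: "A \<in> finite_sets"
  shows "integrable P (W A)" "expectation (W A) = 0"
    and "integrable P (\<lambda>\<omega>. (W A \<omega>)\<^sup>2)" "expectation (\<lambda>\<omega>. (W A \<omega>)\<^sup>2) = measure \<mu> A"
proof -
  note m = centered_normal_moments[of "measure \<mu> A", folded noise_distr'[OF A], simplified]
  show "integrable P (W A)" using m(1) A by (simp add: integrable_distr_eq)
  show "expectation (W A) = 0" using m(2) A by (simp add: integral_distr)
  show "integrable P (\<lambda>\<omega>. (W A \<omega>)\<^sup>2)" using m(3) A by (simp add: integrable_distr_eq)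
  show "expectation (\<lambda>\<omega>. (W A \<omega>)\<^sup>2) = measure \<mu> A" using m(4) A by (simp add: integral_distr)
qed

lemma noise_orthogonal:
  assumes A: "A \<in> finite_sets" and B: "B \<in> finite_sets" and "A \<inter> B = {}"
  shows "has_bochner_integral P (\<lambda>\<omega>. W A \<omega> * W B \<omega>) 0"
proof -
  define C where "C = (\<lambda>i::nat. if i = 0 then A else B)"
  have C: "C i \<in> finite_sets" for i using A B by (simp add: C_def)
  have "indep_vars (\<lambda>_. borel) (\<lambda>i. W (C i)) {..<2}"
    using C \<open>A \<inter> B = {}\<close>
    by (intro noise_indep) (auto simp: finite_sets_def C_def disjoint_family_on_def)
  then have "integrable P (\<lambda>\<omega>. \<Prod>i<2. W (C i) \<omega>)"
    and "expectation (\<lambda>\<omega>. \<Prod>i<2. W (C i) \<omega>) = (\<Prod>i<2. expectation (W (C i)))"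
    using indep_vars_integrable[of "{..<2}" "\<lambda>i. W (C i)"]
      indep_vars_lebesgue_integral[of "{..<2}" "\<lambda>i. W (C i)"] noise_moments(1)[OF C] by auto
  then show ?thesis
    using A B noise_moments by (simp add: C_def numeral_2_eq_2 has_bochner_integral_iff)
qed

text \<open>
  Split both sets along their intersection.  Of the four products, only the square of the noise of
  the common part can have nonzero mean, since disjoint sets carry independent centered noise.
\<close>

lemma noise_covariance:
  assumes A: "A \<in> finite_sets" and B: "B \<in> finite_sets"
  shows "has_bochner_integral P (\<lambda>\<omega>. W A \<omega> * W B \<omega>) (measure \<mu> (A \<inter> B))"
proof -
  let ?C = "A \<inter> B"
  have "has_bochner_integral P (\<lambda>\<omega>. (W ?C \<omega>)\<^sup>2) (measure \<mu> ?C)"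
    using noise_moments[of ?C] A B by (auto simp: has_bochner_integral_iff)
  moreover have "has_bochner_integral P (\<lambda>\<omega>. W ?C \<omega> * W (B - A) \<omega>) 0"
    "has_bochner_integral P (\<lambda>\<omega>. W (A - B) \<omega> * W ?C \<omega>) 0"
    "has_bochner_integral P (\<lambda>\<omega>. W (A - B) \<omega> * W (B - A) \<omega>) 0"
    using A B by (auto intro!: noise_orthogonal)
  ultimately have *: "has_bochner_integral P (\<lambda>\<omega>. (W ?C \<omega>)\<^sup>2 + W ?C \<omega> * W (B - A) \<omega> +
      W (A - B) \<omega> * W ?C \<omega> + W (A - B) \<omega> * W (B - A) \<omega>) (measure \<mu> ?C + 0 + 0 + 0)"
    by (intro has_bochner_integral_add)
  have "AE \<omega> in P. W (?C \<union> (A - B)) \<omega> = W ?C \<omega> + W (A - B) \<omega>"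
    "AE \<omega> in P. W (?C \<union> (B - A)) \<omega> = W ?C \<omega> + W (B - A) \<omega>"
    using A B by (auto intro!: noise_Un)
  moreover have "?C \<union> (A - B) = A" "?C \<union> (B - A) = B" by auto
  ultimately have "AE \<omega> in P. W A \<omega> * W B \<omega> = (W ?C \<omega>)\<^sup>2 + W ?C \<omega> * W (B - A) \<omega> +
      W (A - B) \<omega> * W ?C \<omega> + W (A - B) \<omega> * W (B - A) \<omega>"
    by (auto simp: algebra_simps power2_eq_square)
  then show ?thesis
    using * A B by (subst has_bochner_integral_cong_AE) auto
qed

text \<open>
  Both sides expand to the same quadratic form with matrix \<open>\<mu> (A i \<inter> A j)\<close>.  Overlaps
  are allowed, so that a set can be compared directly with the level sets of a simple function.
\<close>

lemma noise_combination_isometry: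
  assumes "finite I" and A: "\<And>i. i \<in> I \<Longrightarrow> A i \<in> finite_sets"
  shows "(\<integral>\<^sup>+\<omega>. ennreal ((\<Sum>i\<in>I. a i * W (A i) \<omega>)\<^sup>2) \<partial>P) =
    (\<integral>\<^sup>+y. ennreal ((\<Sum>i\<in>I. a i * indicator (A i) y)\<^sup>2) \<partial>\<mu>)"
proof -
  let ?v = "\<Sum>i\<in>I. \<Sum>j\<in>I. a i * a j * measure \<mu> (A i \<inter> A j)"
  have "has_bochner_integral P (\<lambda>\<omega>. \<Sum>i\<in>I. \<Sum>j\<in>I. a i * a j * (W (A i) \<omega> * W (A j) \<omega>)) ?v"
    using A by (intro has_bochner_integral_sum has_bochner_integral_mult_right noise_covariance) auto
  then have P: "has_bochner_integral P (\<lambda>\<omega>. (\<Sum>i\<in>I. a i * W (A i) \<omega>)\<^sup>2) ?v"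
    by (simp add: power2_eq_square sum_product ac_simps)
  have "has_bochner_integral \<mu> (\<lambda>y. \<Sum>i\<in>I. \<Sum>j\<in>I. a i * a j * indicator (A i \<inter> A j) y) ?v"
    using A finite_sets_intros(3)
    by (intro has_bochner_integral_sum has_bochner_integral_mult_right has_bochner_integral_real_indicator)
       (auto simp: finite_sets_def)
  then have \<mu>: "has_bochner_integral \<mu> (\<lambda>y. (\<Sum>i\<in>I. a i * indicator (A i) y)\<^sup>2) ?v"
    by (simp add: power2_eq_square sum_product ac_simps indicator_inter_arith)
  show ?thesis
    using P \<mu> by (simp add: nn_integral_eq_integral has_bochner_integral_iff)
qed

text \<open>
  Only the value \<open>0\<close> may be taken on a set of infinite measure, where the noise is not controlled; in the
  simple integral that set has coefficient \<open>0\<close>.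
\<close>

lemma level_set_in_finite_sets:
  fixes s :: "'b \<Rightarrow> real"
  assumes s: "Bochner_Integration.simple_bochner_integrable \<mu> s" and "c \<noteq> 0"
  shows "{y \<in> space \<mu>. s y = c} \<in> finite_sets"
proof -
  have sf: "simple_function \<mu> s" and supp: "emeasure \<mu> {y \<in> space \<mu>. s y \<noteq> 0} \<noteq> \<infinity>"
    using s by (auto elim: Bochner_Integration.simple_bochner_integrable.cases)
  have [measurable]: "s \<in> borel_measurable \<mu>" using sf by (rule borel_measurable_simple_function)
  have "emeasure \<mu> {y \<in> space \<mu>. s y = c} \<le> emeasure \<mu> {y \<in> space \<mu>. s y \<noteq> 0}"
    using \<open>c \<noteq> 0\<close> by (intro emeasure_mono) auto
  then show ?thesis
    using supp by (auto simp: finite_sets_def top.not_eq_extremum intro: le_less_trans)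
qed

text \<open>
  The difference is a single combination of noises: the level sets of \<open>s\<close> with their values as
  coefficients, together with \<open>A\<close> with coefficient \<open>- 1\<close>.
\<close>

lemma simple_noise_integral_isometry:
  assumes s: "Bochner_Integration.simple_bochner_integrable \<mu> s" and A: "A \<in> finite_sets"
  shows "(\<integral>\<^sup>+\<omega>. ennreal ((simple_noise_integral \<mu> W s \<omega> - W A \<omega>)\<^sup>2) \<partial>P) =
    (\<integral>\<^sup>+y. ennreal ((s y - indicator A y)\<^sup>2) \<partial>\<mu>)"
proof -
  define R where "R = s ` space \<mu> - {0}"
  \<comment> \<open>\<open>None\<close> indexes the set \<open>A\<close> and \<open>Some c\<close> the level set of the nonzero value \<open>c\<close>.\<close>
  define a where "a = (\<lambda>i :: real option. case i of None \<Rightarrow> - 1 | Some c \<Rightarrow> c)"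
  define L where "L = (\<lambda>i. case i of None \<Rightarrow> A | Some c \<Rightarrow> {y \<in> space \<mu>. s y = c})"
  have fin: "finite (s ` space \<mu>)"
    using s by (auto elim: Bochner_Integration.simple_bochner_integrable.cases simp: simple_function_def)
  then have finR: "finite R" by (simp add: R_def)
  have L: "L i \<in> finite_sets" if "i \<in> insert None (Some ` R)" for i
    using that A by (cases i) (auto intro!: level_set_in_finite_sets[OF s] simp: L_def R_def)
  have sum_opt: "(\<Sum>i\<in>insert None (Some ` R). f i) = f None + (\<Sum>c\<in>R. f (Some c))"
    for f :: "real option \<Rightarrow> real"
    using finR by (subst sum.insert) (auto simp: sum.reindex)
  have W: "simple_noise_integral \<mu> W s \<omega> - W A \<omega> = (\<Sum>i\<in>insert None (Some ` R). a i * W (L i) \<omega>)" for \<omega>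
  proof -
    have "simple_noise_integral \<mu> W s \<omega> = (\<Sum>c\<in>R. c * W {y \<in> space \<mu>. s y = c} \<omega>)"
      unfolding simple_noise_integral_def R_def using fin by (intro sum.mono_neutral_right) auto
    then show ?thesis unfolding sum_opt by (simp add: a_def L_def)
  qed
  have ind: "s y - indicator A y = (\<Sum>i\<in>insert None (Some ` R). a i * indicator (L i) y)"
    if y: "y \<in> space \<mu>" for y
  proof -
    have "(\<Sum>c\<in>R. c * indicator {y \<in> space \<mu>. s y = c} y) = (\<Sum>c\<in>R. if c = s y then c else 0)"
      using y by (intro sum.cong) (auto simp: indicator_def)
    also have "\<dots> = s y"
      using finR y by (simp add: sum.delta' R_def)
    finally show ?thesis unfolding sum_opt by (simp add: a_def L_def)
  qed
  have "(\<integral>\<^sup>+\<omega>. ennreal ((simple_noise_integral \<mu> W s \<omega> - W A \<omega>)\<^sup>2) \<partial>P) =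
      (\<integral>\<^sup>+y. ennreal ((\<Sum>i\<in>insert None (Some ` R). a i * indicator (L i) y)\<^sup>2) \<partial>\<mu>)"
    unfolding W using finR L by (intro noise_combination_isometry) auto
  also have "\<dots> = (\<integral>\<^sup>+y. ennreal ((s y - indicator A y)\<^sup>2) \<partial>\<mu>)"
    using ind by (intro nn_integral_cong) simp
  finally show ?thesis .
qed

lemma simple_noise_integral_measurable:
  assumes s: "Bochner_Integration.simple_bochner_integrable \<mu> s"
  shows "simple_noise_integral \<mu> W s \<in> borel_measurable P"
proof -
  have "(\<lambda>\<omega>. c * W {y \<in> space \<mu>. s y = c} \<omega>) \<in> borel_measurable P" for c
    using level_set_in_finite_sets[OF s, of c] by (cases "c = 0") auto
  then show ?thesis unfolding simple_noise_integral_def[abs_def] by (intro borel_measurable_sum)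
qed

lemma has_noise_integral_indicator:
  assumes A: "A \<in> finite_sets" and f: "\<And>y. y \<in> space \<mu> \<Longrightarrow> f y = indicator A y"
  shows "has_noise_integral P \<mu> W f (W A)"
proof -
  let ?s = "\<lambda>n::nat. indicator A :: 'b \<Rightarrow> real"
  have [measurable]: "A \<in> sets \<mu>" using A by (simp add: finite_sets_def)
  have sb: "Bochner_Integration.simple_bochner_integrable \<mu> (indicator A :: 'b \<Rightarrow> real)"
  proof
    have "{y \<in> space \<mu>. indicator A y \<noteq> (0::real)} = A"
      using sets.sets_into_space[of A \<mu>] by (auto simp: indicator_def)
    then show "emeasure \<mu> {y \<in> space \<mu>. indicator A y \<noteq> (0::real)} \<noteq> \<infinity>"
      using A by (simp add: finite_sets_def)
  qed auto
  have "f \<in> borel_measurable \<mu>"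
    using f by (subst measurable_cong[of \<mu> f "indicator A"]) auto
  moreover have "(\<integral>\<^sup>+y. ennreal ((indicator A y - f y)\<^sup>2) \<partial>\<mu>) = (\<integral>\<^sup>+y. 0 \<partial>\<mu>)"
    using f by (intro nn_integral_cong) auto
  moreover have "(\<integral>\<^sup>+\<omega>. ennreal ((simple_noise_integral \<mu> W (indicator A) \<omega> - W A \<omega>)\<^sup>2) \<partial>P) = 0"
    using simple_noise_integral_isometry[OF sb A] by simp
  ultimately show ?thesis
    unfolding has_noise_integral_def using sb A
    by (auto intro!: exI[of _ ?s])
qed

text \<open>
  If simple functions \<open>s n\<close> tend to the indicator of \<open>A\<close>, their integrals tend to \<open>W A\<close> in
  \<open>L\<^sup>2\<close> by the isometry, and they tend to \<open>Z\<close> by assumption.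
\<close>

lemma has_noise_integral_indicator_unique:
  assumes A: "A \<in> finite_sets" and f: "\<And>y. y \<in> space \<mu> \<Longrightarrow> f y = indicator A y"
    and Z: "has_noise_integral P \<mu> W f Z"
  shows "AE \<omega> in P. Z \<omega> = W A \<omega>"
proof -
  obtain s where s: "\<And>n. Bochner_Integration.simple_bochner_integrable \<mu> (s n)"
    and sf: "(\<lambda>n. \<integral>\<^sup>+y. ennreal ((s n y - f y)\<^sup>2) \<partial>\<mu>) \<longlonglongrightarrow> 0"
    and sZ: "(\<lambda>n. \<integral>\<^sup>+\<omega>. ennreal ((simple_noise_integral \<mu> W (s n) \<omega> - Z \<omega>)\<^sup>2) \<partial>P) \<longlonglongrightarrow> 0"
    using Z by (auto simp: has_noise_integral_def)
  have [measurable]: "Z \<in> borel_measurable P" "\<And>n. simple_noise_integral \<mu> W (s n) \<in> borel_measurable P"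
    "W A \<in> borel_measurable P"
    using Z s A by (auto simp: has_noise_integral_def intro: simple_noise_integral_measurable)
  have "(\<integral>\<^sup>+\<omega>. ennreal ((Z \<omega> - W A \<omega>)\<^sup>2) \<partial>P) \<le>
      2 * (\<integral>\<^sup>+\<omega>. ennreal ((simple_noise_integral \<mu> W (s n) \<omega> - Z \<omega>)\<^sup>2) \<partial>P) +
      2 * (\<integral>\<^sup>+y. ennreal ((s n y - f y)\<^sup>2) \<partial>\<mu>)" for n
  proof -
    have pt: "ennreal ((z - w)\<^sup>2) \<le> 2 * ennreal ((i - z)\<^sup>2) + 2 * ennreal ((i - w)\<^sup>2)" for z w i :: real
    proof -
      have "(z - w)\<^sup>2 \<le> 2 * (i - z)\<^sup>2 + 2 * (i - w)\<^sup>2"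
        using zero_le_power2[of "(i - z) + (i - w)"] by (simp add: power2_eq_square algebra_simps)
      then have "ennreal ((z - w)\<^sup>2) \<le> ennreal (2 * (i - z)\<^sup>2 + 2 * (i - w)\<^sup>2)"
        by (rule ennreal_leI)
      also have "\<dots> = 2 * ennreal ((i - z)\<^sup>2) + 2 * ennreal ((i - w)\<^sup>2)"
        by (simp add: ennreal_plus ennreal_mult)
      finally show ?thesis .
    qed
    have "(\<integral>\<^sup>+\<omega>. ennreal ((Z \<omega> - W A \<omega>)\<^sup>2) \<partial>P) \<le>
        (\<integral>\<^sup>+\<omega>. 2 * ennreal ((simple_noise_integral \<mu> W (s n) \<omega> - Z \<omega>)\<^sup>2) +
          2 * ennreal ((simple_noise_integral \<mu> W (s n) \<omega> - W A \<omega>)\<^sup>2) \<partial>P)"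
      by (intro nn_integral_mono pt)
    also have "\<dots> = 2 * (\<integral>\<^sup>+\<omega>. ennreal ((simple_noise_integral \<mu> W (s n) \<omega> - Z \<omega>)\<^sup>2) \<partial>P) +
        2 * (\<integral>\<^sup>+\<omega>. ennreal ((simple_noise_integral \<mu> W (s n) \<omega> - W A \<omega>)\<^sup>2) \<partial>P)"
      by (simp add: nn_integral_add nn_integral_cmult)
    also have "(\<integral>\<^sup>+\<omega>. ennreal ((simple_noise_integral \<mu> W (s n) \<omega> - W A \<omega>)\<^sup>2) \<partial>P) =
        (\<integral>\<^sup>+y. ennreal ((s n y - f y)\<^sup>2) \<partial>\<mu>)"
      unfolding simple_noise_integral_isometry[OF s A] using f by (intro nn_integral_cong) simp
    finally show ?thesis .
  qed
  moreover have "(\<lambda>n. 2 * (\<integral>\<^sup>+\<omega>. ennreal ((simple_noise_integral \<mu> W (s n) \<omega> - Z \<omega>)\<^sup>2) \<partial>P) +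
      2 * (\<integral>\<^sup>+y. ennreal ((s n y - f y)\<^sup>2) \<partial>\<mu>)) \<longlonglongrightarrow> 2 * 0 + 2 * 0"
    using sf sZ by (intro tendsto_add ennreal_tendsto_cmult) auto
  ultimately have "(\<integral>\<^sup>+\<omega>. ennreal ((Z \<omega> - W A \<omega>)\<^sup>2) \<partial>P) \<le> 2 * 0 + 2 * 0"
    by (intro LIMSEQ_le_const) auto
  then have "(\<integral>\<^sup>+\<omega>. ennreal ((Z \<omega> - W A \<omega>)\<^sup>2) \<partial>P) = 0"
    by simp
  then have "AE \<omega> in P. ennreal ((Z \<omega> - W A \<omega>)\<^sup>2) = 0"
    by (subst (asm) nn_integral_0_iff_AE) auto
  then show ?thesis by eventually_elim (simp add: ennreal_eq_0_iff)
qed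

lemma noise_integral_indicator:
  assumes A: "A \<in> finite_sets" and f: "\<And>y. y \<in> space \<mu> \<Longrightarrow> f y = indicator A y"
  shows "noise_integral P \<mu> W f \<in> borel_measurable P"
    and "AE \<omega> in P. noise_integral P \<mu> W f \<omega> = W A \<omega>"
proof -
  have "has_noise_integral P \<mu> W f (W A)"
    using A f by (rule has_noise_integral_indicator)
  then have "has_noise_integral P \<mu> W f (noise_integral P \<mu> W f)"
    unfolding noise_integral_def by (rule someI[of "has_noise_integral P \<mu> W f"])
  then show "noise_integral P \<mu> W f \<in> borel_measurable P"
    and "AE \<omega> in P. noise_integral P \<mu> W f \<omega> = W A \<omega>"
    using has_noise_integral_indicator_unique[OF A f] by (auto simp: has_noise_integral_def)
qed

end

section \<open>Noise of a growing family of sets\<close>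

text \<open>
  Increments of \<open>t \<mapsto> W (A t)\<close> are noises of the disjoint shells \<open>A t - A s\<close>, hence independent,
  and centered normal with variance \<open>K * t ^ p - K * s ^ p\<close>; these are also the increments of the
  time-changed Brownian motion.
\<close>

lemma (in gaussian_noise) noise_of_growing_sets_eq_fdd:
  fixes A :: "real \<Rightarrow> 'b set" and K :: real and p :: nat
  assumes A: "\<And>t. t \<ge> 0 \<Longrightarrow> A t \<in> finite_sets"
    and mono: "\<And>s t. 0 \<le> s \<Longrightarrow> s \<le> t \<Longrightarrow> A s \<subseteq> A t"
    and meas: "\<And>t. t \<ge> 0 \<Longrightarrow> measure \<mu> (A t) = K * t ^ p"
    and "p > 0" "K \<ge> 0"
    and "standard_brownian_motion N B"
  shows "eq_fdd {0..} P (\<lambda>t. W (A t)) N (\<lambda>t. B (K * t ^ p))"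
proof -
  interpret N: standard_brownian_motion N B by fact
  have BM: "B (K * t ^ p) \<in> borel_measurable N" if "t \<ge> 0" for t
    using that \<open>K \<ge> 0\<close> by (intro N.bm_measurable) auto
  show ?thesis
  proof (cases "K = 0")
    case True
    \<comment> \<open>The time change is constant, and both processes vanish almost surely at each time.\<close>
    show ?thesis
    proof (rule eq_fdd_cong_AE[OF eq_fdd_constant[where c = "\<lambda>_. 0"]])
      show "AE \<omega> in P. W (A t) \<omega> = 0" if "t \<in> {0..}" for t
        using that A meas[of t] True by (intro noise_null) auto
      show "AE \<omega> in N. B (K * t ^ p) \<omega> = 0" for t
        using N.bm_zero True by simp
    qed (use A BM prob_space_axioms N.prob_space_axioms in auto)
  next
    case False
    then have "K > 0" using \<open>K \<ge> 0\<close> by simp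
    have time: "K * s ^ p < K * t ^ p" if "0 \<le> s" "s < t" for s t
      using that \<open>K > 0\<close> \<open>p > 0\<close> by (simp add: power_strict_mono)
    have W_incr: "AE \<omega> in P. W (A t - A s) \<omega> = W (A t) \<omega> - W (A s) \<omega>" if "0 \<le> s" "s < t" for s t
      using that A mono by (intro noise_Diff) auto
    show ?thesis
    proof (rule eq_fdd_independent_increments)
      show "AE \<omega> in P. W (A 0) \<omega> = 0"
        using A[of 0] meas[of 0] \<open>p > 0\<close> by (intro noise_null) auto
      show "AE \<omega> in N. B (K * 0 ^ p) \<omega> = 0"
        using N.bm_zero \<open>p > 0\<close> by (simp add: power_0_left)
    next
      fix s t :: real assume st: "0 \<le> s" "s < t"
      have "distr P borel (\<lambda>\<omega>. W (A t) \<omega> - W (A s) \<omega>) = distr P borel (W (A t - A s))"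
        using W_incr[OF st] st A[of s] A[of t] by (intro distr_cong_AE) (auto intro: noise_measurable')
      also have "\<dots> = centered_normal (measure \<mu> (A t - A s))"
        using st A by (intro noise_distr') auto
      also have "measure \<mu> (A t - A s) = K * t ^ p - K * s ^ p"
        using st A[of s] A[of t] mono[of s t] meas by (subst measure_Diff) (auto simp: finite_sets_def)
      also have "centered_normal \<dots> = distr N borel (\<lambda>\<omega>. B (K * t ^ p) \<omega> - B (K * s ^ p) \<omega>)"
        using time[OF st] st \<open>K > 0\<close> by (intro N.bm_increments[symmetric]) auto
      finally show "distr P borel (\<lambda>\<omega>. W (A t) \<omega> - W (A s) \<omega>) =
          distr N borel (\<lambda>\<omega>. B (K * t ^ p) \<omega> - B (K * s ^ p) \<omega>)" .
    next
      fix u :: "nat \<Rightarrow> real" and n :: nat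
      assume "n > 0" and u: "\<And>i. i < n \<Longrightarrow> u i < u (Suc i)"
        and u_nonneg: "\<And>i. i \<le> n \<Longrightarrow> u i \<ge> 0"
      have u_mono: "u i \<le> u j" if "i \<le> j" "j \<le> n" for i j
        using that
      proof (induction j rule: dec_induct)
        case (step m)
        then show ?case using u[of m] by simp
      qed simp
      have disj: "(A (u (Suc i)) - A (u i)) \<inter> (A (u (Suc j)) - A (u j)) = {}"
        if "i < j" "j < n" for i j
        using mono[of "u (Suc i)" "u j"] u_nonneg[of "Suc i"] u_mono[of "Suc i" j] that by auto
      have "indep_vars (\<lambda>_. borel) (\<lambda>i. W (A (u (Suc i)) - A (u i))) {..<n}"
      proof (rule noise_indep)
        show "A (u (Suc i)) - A (u i) \<in> sets \<mu> \<and> emeasure \<mu> (A (u (Suc i)) - A (u i)) < \<infinity>"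
          if "i < n" for i
          using A u_nonneg that finite_sets_intros(4)[of "A (u (Suc i))" "A (u i)"]
          unfolding finite_sets_def by auto
        show "disjoint_family_on (\<lambda>i. A (u (Suc i)) - A (u i)) {..<n}"
          unfolding disjoint_family_on_def
        proof (intro ballI impI)
          fix i j assume "i \<in> {..<n}" "j \<in> {..<n}" "i \<noteq> j"
          then show "(A (u (Suc i)) - A (u i)) \<inter> (A (u (Suc j)) - A (u j)) = {}"
            using disj[of i j] disj[of j i] by (cases "i < j") (auto simp: Int_commute)
        qed
      qed
      then show "indep_vars (\<lambda>_. borel) (\<lambda>i \<omega>. W (A (u (Suc i))) \<omega> - W (A (u i)) \<omega>) {..<n}"
        using \<open>n > 0\<close> A u u_nonneg W_incr
        by (elim indep_vars_cong_AE) (auto intro!: borel_measurable_diff)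
      show "N.indep_vars (\<lambda>_. borel)
          (\<lambda>i \<omega>. B (K * u (Suc i) ^ p) \<omega> - B (K * u i ^ p) \<omega>) {..<n}"
        using \<open>K > 0\<close> u u_nonneg time
        by (intro N.bm_indep[of "\<lambda>i. K * u i ^ p"]) auto
    qed (use A BM prob_space_axioms N.prob_space_axioms in auto)
  qed
qed

section \<open>Lebesgue measure under dilations\<close>

lemma emeasure_lborel_scaleR_vimage:
  fixes X :: "'a::euclidean_space set"
  assumes "t > 0" and X: "X \<in> sets borel"
  shows "emeasure lborel X = ennreal (t ^ DIM('a)) * emeasure lborel ((\<lambda>x. t *\<^sub>R x) -` X)"
proof -
  have [measurable]: "(\<lambda>x::'a. t *\<^sub>R x) \<in> borel_measurable lborel" by simp
  have "emeasure lborel X = emeasure (density (distr lborel borel (\<lambda>x::'a. 0 + t *\<^sub>R x)) (\<lambda>_. ennreal (\<bar>t\<bar> ^ DIM('a)))) X"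
    using \<open>t > 0\<close> by (subst lborel_affine[of t 0, symmetric]) auto
  also have "\<dots> = ennreal (t ^ DIM('a)) * emeasure (distr lborel borel (\<lambda>x::'a. t *\<^sub>R x)) X"
    using assms by (simp add: emeasure_density nn_integral_cmult)
  also have "emeasure (distr lborel borel (\<lambda>x::'a. t *\<^sub>R x)) X = emeasure lborel ((\<lambda>x. t *\<^sub>R x) -` X)"
    using assms by (subst emeasure_distr) auto
  finally show ?thesis .
qed

lemma emeasure_PiM_lborel_scaleR_vimage:
  fixes X :: "('i \<Rightarrow> 'a::euclidean_space) set"
  assumes "finite I" "t > 0" and X: "X \<in> sets (PiM I (\<lambda>_. lborel))"
  shows "emeasure (PiM I (\<lambda>_. lborel)) X = ennreal (t ^ (DIM('a) * card I)) *
    emeasure (PiM I (\<lambda>_. lborel)) ((\<lambda>y. \<lambda>i\<in>I. t *\<^sub>R y i) -` X \<inter> space (PiM I (\<lambda>_. lborel)))"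
proof -
  interpret product_sigma_finite "\<lambda>_ :: 'i. lborel :: 'a measure" ..
  let ?M = "PiM I (\<lambda>_. lborel :: 'a measure)" and ?g = "\<lambda>y :: 'i \<Rightarrow> 'a. \<lambda>i\<in>I. t *\<^sub>R y i"
  have g: "?g \<in> measurable ?M ?M"
    by (intro measurable_restrict) simp
  have "scale_measure (ennreal (t ^ (DIM('a) * card I))) (distr ?M ?M ?g) = ?M"
  proof (rule PiM_eqI)
    fix A :: "'i \<Rightarrow> 'a set" assume A: "\<And>i. i \<in> I \<Longrightarrow> A i \<in> sets lborel"
    have vimage: "(\<lambda>x. t *\<^sub>R x) -` A i \<in> sets lborel" if "i \<in> I" for i
    proof -
      have "(\<lambda>x. t *\<^sub>R x) -` A i \<inter> space lborel \<in> sets lborel"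
        using A[OF that] by (intro measurable_sets[of _ _ borel]) auto
      then show ?thesis by simp
    qed
    have "?g -` Pi\<^sub>E I A \<inter> space ?M = Pi\<^sub>E I (\<lambda>i. (\<lambda>x. t *\<^sub>R x) -` A i)"
      by (auto simp: space_PiM PiE_iff)
    then have "emeasure (distr ?M ?M ?g) (Pi\<^sub>E I A) = (\<Prod>i\<in>I. emeasure lborel ((\<lambda>x. t *\<^sub>R x) -` A i))"
      using A g \<open>finite I\<close> vimage
      by (subst emeasure_distr) (auto intro!: sets_PiM_I_finite emeasure_PiM)
    moreover have "(\<Prod>i\<in>I. emeasure lborel (A i)) =
        (\<Prod>i\<in>I. ennreal (t ^ DIM('a)) * emeasure lborel ((\<lambda>x. t *\<^sub>R x) -` A i))"
      using A \<open>t > 0\<close> by (intro prod.cong emeasure_lborel_scaleR_vimage) auto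
    moreover have "ennreal (t ^ DIM('a)) ^ card I = ennreal (t ^ (DIM('a) * card I))"
      using \<open>t > 0\<close> by (simp add: ennreal_power power_mult)
    ultimately show "emeasure (scale_measure (ennreal (t ^ (DIM('a) * card I))) (distr ?M ?M ?g)) (Pi\<^sub>E I A) =
        (\<Prod>i\<in>I. emeasure lborel (A i))"
      by (simp add: prod.distrib)
  qed (use \<open>finite I\<close> in auto)
  then have "emeasure ?M X = emeasure (scale_measure (ennreal (t ^ (DIM('a) * card I))) (distr ?M ?M ?g)) X"
    by simp
  then show ?thesis
    using g X by (simp add: emeasure_distr)
qed

section \<open>Isomorphism, monotonicity and diameter of geometric graphs\<close>

lemma geometric_graph_simps [simp]:
  "pverts (geometric_graph X t) = X"
  "(u, v) \<in> parcs (geometric_graph X t) \<longleftrightarrow> u \<in> X \<and> v \<in> X \<and> u \<noteq> v \<and> dist u v \<le> t"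
  by (auto simp: geometric_graph_def)

lemma wf_geometric_graph: "wf_digraph (with_proj (geometric_graph X t))"
  unfolding wf_digraph_wp_iff by unfold_locales (auto simp: geometric_graph_def)

lemma digraph_iso_connected:
  assumes "digraph_iso G H" "wf_digraph G" "Digraph_Component.connected G"
  shows "Digraph_Component.connected H"
  using assms wf_digraph.connectedI_app_iso by (auto simp: digraph_iso_def)

lemma digraph_iso_card_verts:
  assumes "digraph_iso G H"
  shows "card (verts H) = card (verts G)"
  using assms card_verts_iso by (auto simp: digraph_iso_def)

text \<open>
  Arcs are pairs of vertices on both sides, which forces the isomorphism to act on an arc by its vertex
  map; that map then carries unordered edges injectively to unordered edges.
\<close>

lemma digraph_iso_num_edges:
  assumes "digraph_iso (with_proj G) (with_proj H)" and wf: "wf_digraph (with_proj G)"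
  shows "num_edges H = num_edges G"
proof -
  obtain hom where hom: "pre_digraph.digraph_isomorphism (with_proj G) hom"
    and H: "with_proj H = app_iso hom (with_proj G)"
    using assms by (auto simp: digraph_iso_def)
  define f where "f = iso_verts hom"
  have tail: "iso_tail hom = fst" and head: "iso_head hom = snd"
    and arcs: "parcs H = iso_arcs hom ` parcs G"
    using arg_cong[OF H, of tail] arg_cong[OF H, of head] arg_cong[OF H, of arcs] by simp_all
  have hom_arc: "iso_arcs hom (u, v) = (f u, f v)" if "(u, v) \<in> parcs G" for u v
    using hom that by (auto simp: pre_digraph.digraph_isomorphism_def f_def tail head prod_eq_iff)
  have inj: "inj_on f (pverts G)"
    using hom by (simp add: pre_digraph.digraph_isomorphism_def f_def)
  have "{{u, v} |u v. (u, v) \<in> parcs H} = (`) f ` {{u, v} |u v. (u, v) \<in> parcs G}"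
  proof (intro equalityI subsetI)
    fix e assume "e \<in> {{u, v} |u v. (u, v) \<in> parcs H}"
    then obtain u v where "e = {f u, f v}" "(u, v) \<in> parcs G"
      unfolding arcs using hom_arc by force
    then show "e \<in> (`) f ` {{u, v} |u v. (u, v) \<in> parcs G}"
      by (intro image_eqI[of _ _ "{u, v}"]) auto
  next
    fix e assume "e \<in> (`) f ` {{u, v} |u v. (u, v) \<in> parcs G}"
    then obtain u v where "e = {f u, f v}" "(u, v) \<in> parcs G" by auto
    then show "e \<in> {{u, v} |u v. (u, v) \<in> parcs H}"
      unfolding arcs using hom_arc[of u v] by force
  qed
  moreover have "{{u, v} |u v. (u, v) \<in> parcs G} \<subseteq> Pow (pverts G)"
    using wf by (auto simp: wf_digraph_wp_iff dest: pair_wf_digraph.in_arcsD1 pair_wf_digraph.in_arcsD2)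
  ultimately show ?thesis
    unfolding num_edges_def
    using inj by (auto intro!: card_image intro: inj_on_subset[OF inj_on_image_Pow])
qed

text \<open>
  Matching the points by their index is an isomorphism.  The two scales may differ, so that this covers
  dilations as well as configurations with equal patterns.
\<close>

lemma digraph_iso_geometric_graph:
  fixes x :: "'i \<Rightarrow> 'a::metric_space" and x' :: "'i \<Rightarrow> 'b::metric_space"
  assumes x: "inj_on x I" and x': "inj_on x' I"
    and pat: "\<And>i j. i \<in> I \<Longrightarrow> j \<in> I \<Longrightarrow> dist (x i) (x j) \<le> t \<longleftrightarrow> dist (x' i) (x' j) \<le> t'"
  shows "digraph_iso (with_proj (geometric_graph (x ` I) t)) (with_proj (geometric_graph (x' ` I) t'))"
proof -
  define f where "f = (\<lambda>u. x' (inv_into I x u))"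
  have f: "f (x i) = x' i" if "i \<in> I" for i
    using that x by (simp add: f_def)
  define hom where "hom = \<lparr>iso_verts = f, iso_arcs = map_prod f f, iso_head = snd, iso_tail = fst\<rparr>"
  have inj: "inj_on f (x ` I)"
    using x x' f by (auto intro!: inj_onI dest: inj_onD)
  have arcs: "parcs (geometric_graph (x' ` I) t') = map_prod f f ` parcs (geometric_graph (x ` I) t)"
  proof (intro equalityI subsetI)
    fix e assume "e \<in> parcs (geometric_graph (x' ` I) t')"
    then obtain i j where "i \<in> I" "j \<in> I" "e = (x' i, x' j)" "x' i \<noteq> x' j" "dist (x' i) (x' j) \<le> t'"
      by (cases e) auto
    then show "e \<in> map_prod f f ` parcs (geometric_graph (x ` I) t)"
      using f pat x by (intro image_eqI[of _ _ "(x i, x j)"]) (auto dest: inj_onD)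
  next
    fix e assume "e \<in> map_prod f f ` parcs (geometric_graph (x ` I) t)"
    then obtain i j where "i \<in> I" "j \<in> I" "e = (x' i, x' j)" "x i \<noteq> x j" "dist (x i) (x j) \<le> t"
      using f by (auto simp: geometric_graph_def)
    then show "e \<in> parcs (geometric_graph (x' ` I) t')"
      using pat x' by (auto dest: inj_onD)
  qed
  have "inj_on (map_prod f f) (x ` I \<times> x ` I)"
    using inj by (intro map_prod_inj_on)
  then have inj_arcs: "inj_on (map_prod f f) (parcs (geometric_graph (x ` I) t))"
    by (rule inj_on_subset) (auto simp: geometric_graph_def)
  have "pre_digraph.digraph_isomorphism (with_proj (geometric_graph (x ` I) t)) hom"
    using inj inj_arcs wf_geometric_graph by (auto simp: pre_digraph.digraph_isomorphism_def hom_def)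
  moreover have "with_proj (geometric_graph (x' ` I) t') = app_iso hom (with_proj (geometric_graph (x ` I) t))"
    using arcs f by (auto simp: with_proj_def app_iso_def hom_def image_image)
  ultimately show ?thesis
    unfolding digraph_iso_def by blast
qed

lemma geometric_graph_mono:
  assumes "s \<le> t"
  shows "parcs (geometric_graph X s) \<subseteq> parcs (geometric_graph X t)"
  using assms by (auto simp: geometric_graph_def)

lemma connected_geometric_graph_mono:
  assumes "Digraph_Component.connected (with_proj (geometric_graph X s))" "s \<le> t"
  shows "Digraph_Component.connected (with_proj (geometric_graph X t))"
proof -
  have "symcl (parcs (geometric_graph X s)) \<subseteq> symcl (parcs (geometric_graph X t))"
    using geometric_graph_mono[OF \<open>s \<le> t\<close>, of X] by (auto simp: symcl_def)
  then show ?thesis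
    using assms(1) by (auto simp: connected_conv intro: rtrancl_on_mono)
qed

lemma finite_edges_geometric_graph:
  assumes "finite X"
  shows "finite {{u, v} |u v. (u, v) \<in> parcs (geometric_graph X t)}"
  by (rule finite_subset[of _ "Pow X"]) (use assms in auto)

lemma num_edges_geometric_graph_mono:
  assumes "finite X" "s \<le> t"
  shows "num_edges (geometric_graph X s) \<le> num_edges (geometric_graph X t)"
  unfolding num_edges_def
  using geometric_graph_mono[OF \<open>s \<le> t\<close>, of X]
  by (intro card_mono finite_edges_geometric_graph[OF \<open>finite X\<close>]) blast

text \<open>
  The smaller graph is contained in the larger one, and a finite edge set has no proper subset of the
  same cardinality.
\<close>

lemma geometric_graph_eqI_num_edges:
  assumes "finite X" "s \<le> t" "num_edges (geometric_graph X s) = num_edges (geometric_graph X t)"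
  shows "geometric_graph X s = geometric_graph X t"
proof -
  have eq: "{{u, v} |u v. (u, v) \<in> parcs (geometric_graph X s)} =
      {{u, v} |u v. (u, v) \<in> parcs (geometric_graph X t)}"
    using assms(3) geometric_graph_mono[OF \<open>s \<le> t\<close>, of X] unfolding num_edges_def
    by (intro card_subset_eq finite_edges_geometric_graph[OF \<open>finite X\<close>]) blast+
  have "(u, v) \<in> parcs (geometric_graph X s)" if "(u, v) \<in> parcs (geometric_graph X t)" for u v
  proof -
    have "{u, v} \<in> {{u, v} |u v. (u, v) \<in> parcs (geometric_graph X s)}"
      unfolding eq using that by blast
    then obtain a b where "{u, v} = {a, b}" "(a, b) \<in> parcs (geometric_graph X s)"
      by blast
    then show ?thesis
      by (auto simp: doubleton_eq_iff dist_commute)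
  qed
  then have "parcs (geometric_graph X s) = parcs (geometric_graph X t)"
    using geometric_graph_mono[OF \<open>s \<le> t\<close>, of X] by auto
  then show ?thesis by (simp add: geometric_graph_def)
qed

text \<open>
  Two points are joined by a chain of steps of length at most \<open>t\<close>, and a chain can be chosen with no more
  steps than there are ordered pairs of points.  The bound is crude; only boundedness and the value \<open>0\<close>
  at \<open>t = 0\<close> matter.
\<close>

lemma connected_geometric_graph_diameter:
  assumes conn: "Digraph_Component.connected (with_proj (geometric_graph X t))"
    and "finite X" "t \<ge> 0" "u \<in> X" "v \<in> X"
  shows "dist u v \<le> real (card X ^ 2) * t"
proof -
  define R where "R = {(a, b) \<in> X \<times> X. dist a b \<le> t}"
  have R: "R \<subseteq> X \<times> X" "finite R"
    using \<open>finite X\<close> by (auto simp: R_def intro: finite_subset[of _ "X \<times> X"])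
  have "symcl (parcs (geometric_graph X t)) \<subseteq> R"
    by (auto simp: symcl_def R_def dist_commute)
  moreover have "(u, v) \<in> (symcl (parcs (geometric_graph X t)))\<^sup>*"
    using conn \<open>u \<in> X\<close> \<open>v \<in> X\<close> by (auto simp: connected_conv intro: rtrancl_on_rtranclI)
  ultimately have "(u, v) \<in> R\<^sup>*"
    using rtrancl_mono by blast
  then obtain n where n: "n \<le> card R" "(u, v) \<in> R ^^ n"
    using rtrancl_finite_eq_relpow[OF \<open>finite R\<close>] by auto
  have "dist u w \<le> real n * t" if "(u, w) \<in> R ^^ n" for n w
    using that
  proof (induction n arbitrary: w)
    case (Suc n)
    then obtain y where "(u, y) \<in> R ^^ n" "(y, w) \<in> R" by auto
    then have "dist u y \<le> real n * t" "dist y w \<le> t"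
      using Suc.IH by (auto simp: R_def)
    then show ?case
      using dist_triangle[of u w y] by (simp add: algebra_simps)
  qed simp
  then have "dist u v \<le> real n * t" using n by simp
  also have "\<dots> \<le> real (card R) * t"
    using n \<open>t \<ge> 0\<close> by (intro mult_right_mono) auto
  also have "\<dots> \<le> real (card X ^ 2) * t"
    using card_mono[OF _ R(1)] \<open>finite X\<close> \<open>t \<ge> 0\<close>
    by (intro mult_right_mono) (auto simp: card_cartesian_product power2_eq_square simp flip: of_nat_mult)
  finally show ?thesis .
qed

section \<open>Processes driven by connected configurations\<close>

lemma sets_distance_pattern:
  fixes X :: "nat \<Rightarrow> 'b \<Rightarrow> 'a::euclidean_space"
  assumes [measurable]: "\<And>i. X i \<in> borel_measurable M"
  shows "{y \<in> space M. (\<forall>i\<in>{1..k}. \<forall>j\<in>{1..k}. X i y = X j y \<longrightarrow> i = j) \<and>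
    (\<forall>i\<in>{1..k}. \<forall>j\<in>{1..k}. dist (X i y) (X j y) \<le> t \<longleftrightarrow> (i, j) \<in> E)} \<in> sets M"
  by measurable

text \<open>
  What the families \<open>h\<^sup>+\<close> and \<open>h\<^sup>-\<close> have in common.  A configuration \<open>x\<close> at scale \<open>t\<close> counts only if its
  points are distinct and its geometric graph is connected (which keeps it bounded); whether it counts
  depends only on which pairs are within distance \<open>t\<close> (which gives measurability and
  invariance under dilation); and a configuration that counts continues to count at larger scales
  (which makes the process have independent increments).
\<close>

locale connected_graph_property =
  fixes k :: nat and Q :: "real \<Rightarrow> (nat \<Rightarrow> real ^ 'd::finite) \<Rightarrow> bool"
  assumes k: "k \<ge> 2"
    and Q_inj: "\<And>t x. Q t x \<Longrightarrow> inj_on x {1..k}"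
    and Q_connected: "\<And>t x. Q t x \<Longrightarrow>
      Digraph_Component.connected (with_proj (geometric_graph (x ` {1..k}) t))"
    and Q_invariant: "\<And>t t' x x'. inj_on x {1..k} \<Longrightarrow> inj_on x' {1..k} \<Longrightarrow>
      (\<And>i j. i \<in> {1..k} \<Longrightarrow> j \<in> {1..k} \<Longrightarrow> dist (x i) (x j) \<le> t \<longleftrightarrow> dist (x' i) (x' j) \<le> t') \<Longrightarrow>
      Q t x \<Longrightarrow> Q t' x'"
    and Q_mono: "\<And>s t x. s \<le> t \<Longrightarrow> Q s x \<Longrightarrow> Q t x"
begin

definition region :: "real \<Rightarrow> (nat \<Rightarrow> real ^ 'd) set" where
  "region t = {y \<in> space (lambda_k k). Q t (y(1 := 0))}"

lemma region_mono: "s \<le> t \<Longrightarrow> region s \<subseteq> region t"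
  using Q_mono by (auto simp: region_def)

text \<open>
  The region is a finite union over the admissible patterns \<open>E\<close> of pairs within distance \<open>t\<close>; fixing the
  pattern imposes finitely many closed or open conditions on the coordinates.
\<close>

lemma region_measurable: "region t \<in> sets (lambda_k k)"
proof -
  define pat where "pat = (\<lambda>x :: nat \<Rightarrow> real ^ 'd. {(i, j) \<in> {1..k} \<times> {1..k}. dist (x i) (x j) \<le> t})"
  define good where "good = {pat x |x. inj_on x {1..k} \<and> Q t x}"
  \<comment> \<open>The \<open>i\<close>-th point of the configuration \<open>(0, y)\<close>, made total in \<open>i\<close> so that it is always measurable.\<close>
  define X where "X = (\<lambda>i (y :: nat \<Rightarrow> real ^ 'd). if i \<in> {2..k} then y i else 0)"
  have X: "(y(1 := 0)) i = X i y" if "i \<in> {1..k}" for i y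
    using that by (auto simp: X_def)
  have X_meas: "X i \<in> borel_measurable (lambda_k k)" for i
  proof (cases "i \<in> {2..k}")
    case True
    then have "(\<lambda>y. y i) \<in> measurable (lambda_k k :: (nat \<Rightarrow> real ^ 'd) measure) lborel"
      unfolding lambda_k_def by (intro measurable_component_singleton)
    then show ?thesis using True by (simp add: X_def)
  next
    case False
    then have "X i = (\<lambda>_. 0)" unfolding X_def by auto
    then show ?thesis by simp
  qed
  have Q_iff: "Q t x \<longleftrightarrow> inj_on x {1..k} \<and> pat x \<in> good" for x
  proof
    assume "inj_on x {1..k} \<and> pat x \<in> good"
    then obtain x' where "inj_on x {1..k}" "inj_on x' {1..k}" "Q t x'" "pat x' = pat x"
      by (auto simp: good_def)
    moreover have "dist (x' i) (x' j) \<le> t \<longleftrightarrow> dist (x i) (x j) \<le> t" if "i \<in> {1..k}" "j \<in> {1..k}" for i j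
      using \<open>pat x' = pat x\<close> that unfolding pat_def by blast
    ultimately show "Q t x" using Q_invariant[of x' x t t] by blast
  next
    assume "Q t x"
    then show "inj_on x {1..k} \<and> pat x \<in> good"
      using Q_inj[of t x] unfolding good_def by blast
  qed
  have "finite good"
    by (rule finite_subset[of _ "Pow ({1..k} \<times> {1..k})"]) (auto simp: good_def pat_def)
  define R where "R = (\<lambda>E. {y \<in> space (lambda_k k).
      (\<forall>i\<in>{1..k}. \<forall>j\<in>{1..k}. X i y = X j y \<longrightarrow> i = j) \<and>
      (\<forall>i\<in>{1..k}. \<forall>j\<in>{1..k}. dist (X i y) (X j y) \<le> t \<longleftrightarrow> (i, j) \<in> E)})"
  have R: "R E \<in> sets (lambda_k k)" for E
    unfolding R_def using X_meas by (rule sets_distance_pattern)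
  have "R E = {y \<in> space (lambda_k k). inj_on (y(1 := 0)) {1..k} \<and> pat (y(1 := 0)) = E}"
    if "E \<in> good" for E
  proof -
    have "pat x = E \<longleftrightarrow> (\<forall>i\<in>{1..k}. \<forall>j\<in>{1..k}. dist (x i) (x j) \<le> t \<longleftrightarrow> (i, j) \<in> E)" for x
    proof -
      have "E \<subseteq> {1..k} \<times> {1..k}" "pat x \<subseteq> {1..k} \<times> {1..k}"
        using that unfolding good_def pat_def by blast+
      then have "pat x = E \<longleftrightarrow> (\<forall>i\<in>{1..k}. \<forall>j\<in>{1..k}. (i, j) \<in> pat x \<longleftrightarrow> (i, j) \<in> E)"
        by blast
      then show ?thesis by (simp add: pat_def)
    qed
    then show ?thesis
      unfolding R_def inj_on_def by (simp only: X cong: ball_cong)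
  qed
  then have "(\<Union>E\<in>good. R E) =
      (\<Union>E\<in>good. {y \<in> space (lambda_k k). inj_on (y(1 := 0)) {1..k} \<and> pat (y(1 := 0)) = E})"
    by (intro SUP_cong refl)
  also have "\<dots> = region t"
    unfolding region_def Q_iff by blast
  finally have "region t = (\<Union>E\<in>good. R E)" by (rule sym)
  then show ?thesis
    using \<open>finite good\<close> R by auto
qed

lemma region_bounded:
  assumes "y \<in> region t" "t \<ge> 0" "i \<in> {2..k}"
  shows "norm (y i) \<le> real (k ^ 2) * t"
proof -
  let ?x = "y(1 := 0)"
  have Q: "Q t ?x" using assms by (simp add: region_def)
  have "dist (?x i) (?x 1) \<le> real (card (?x ` {1..k}) ^ 2) * t"
    using k assms by (intro connected_geometric_graph_diameter Q_connected[OF Q] imageI) auto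
  also have "card (?x ` {1..k}) = k"
    using card_image[OF Q_inj[OF Q]] by simp
  finally show ?thesis using assms by simp
qed

lemma region_finite_measure:
  assumes "t \<ge> 0"
  shows "emeasure (lambda_k k) (region t) < \<infinity>"
proof -
  interpret product_sigma_finite "\<lambda>_ :: nat. lborel :: (real ^ 'd) measure" ..
  let ?C = "Pi\<^sub>E {2..k} (\<lambda>_. cball 0 (real (k ^ 2) * t) :: (real ^ 'd) set)"
  have "region t \<subseteq> ?C"
  proof
    fix y assume y: "y \<in> region t"
    then have "y \<in> extensional {2..k}" by (simp add: region_def lambda_k_def space_PiM PiE_iff)
    then show "y \<in> ?C" using region_bounded[OF y assms] by (simp add: PiE_iff)
  qed
  then have "emeasure (lambda_k k) (region t) \<le> emeasure (lambda_k k) ?C"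
    unfolding lambda_k_def by (intro emeasure_mono sets_PiM_I_finite) auto
  also have "\<dots> = (\<Prod>i\<in>{2..k}. emeasure lborel (cball 0 (real (k ^ 2) * t) :: (real ^ 'd) set))"
    unfolding lambda_k_def by (intro emeasure_PiM) auto
  also have "\<dots> < \<infinity>"
    using emeasure_bounded_finite[OF bounded_cball, of "0 :: real ^ 'd" "real (k ^ 2) * t"]
    by (simp add: prod_constant power_less_top_ennreal)
  finally show ?thesis .
qed

lemma region_zero: "region 0 = {}"
proof (rule ccontr)
  assume "region 0 \<noteq> {}"
  then obtain y where y: "y \<in> region 0" by auto
  then have "inj_on (y(1 := 0)) {1..k}" using Q_inj by (auto simp: region_def)
  moreover have "y 2 = 0" using region_bounded[OF y, of 2] k by simp
  ultimately have "(2 :: nat) = 1"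
    using k by (intro inj_onD[of "y(1 := 0)" "{1..k}" 2 1]) auto
  then show False by simp
qed

text \<open>
  Dilating all points and the scale by \<open>t\<close> leaves the pattern of close pairs unchanged.
\<close>

lemma region_scale:
  assumes "t > 0"
  shows "(\<lambda>y. \<lambda>i\<in>{2..k}. t *\<^sub>R y i) -` region t \<inter> space (lambda_k k) = region 1"
proof -
  have "Q t ((\<lambda>i\<in>{2..k}. t *\<^sub>R y i)(1 := 0)) \<longleftrightarrow> Q 1 (y(1 := 0))" for y :: "nat \<Rightarrow> real ^ 'd"
  proof -
    let ?x = "y(1 := 0)" and ?tx = "(\<lambda>i\<in>{2..k}. t *\<^sub>R y i)(1 := 0)"
    have tx: "?tx i = t *\<^sub>R ?x i" if "i \<in> {1..k}" for i
      using that by auto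
    have inj: "inj_on ?tx {1..k} \<longleftrightarrow> inj_on ?x {1..k}"
      unfolding inj_on_def using tx \<open>t > 0\<close> by (intro ball_cong refl) (auto simp: tx)
    have "dist (t *\<^sub>R a) (t *\<^sub>R b) = t * dist a b" for a b :: "real ^ 'd"
      using \<open>t > 0\<close> by (simp add: dist_norm flip: scaleR_diff_right)
    then have "dist (?tx i) (?tx j) = t * dist (?x i) (?x j)" if "i \<in> {1..k}" "j \<in> {1..k}" for i j
      unfolding tx[OF that(1)] tx[OF that(2)] .
    then have pat: "dist (?tx i) (?tx j) \<le> t \<longleftrightarrow> dist (?x i) (?x j) \<le> 1"
      if "i \<in> {1..k}" "j \<in> {1..k}" for i j
      using that \<open>t > 0\<close> by simp
    show ?thesis
      using Q_invariant[of ?tx ?x t 1] Q_invariant[of ?x ?tx 1 t] Q_inj[of t ?tx] Q_inj[of 1 ?x] inj pat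
      by blast
  qed
  then show ?thesis
    by (auto simp: region_def lambda_k_def space_PiM)
qed

lemma measure_region:
  assumes "t \<ge> 0"
  shows "measure (lambda_k k) (region t) =
    measure (lambda_k k) (region 1) * t ^ (CARD('d) * (k - 1))"
proof (cases "t = 0")
  case True
  then show ?thesis using k by (simp add: region_zero power_0_left)
next
  case False
  then have "t > 0" using assms by simp
  have "emeasure (lambda_k k) (region t) =
      ennreal (t ^ (CARD('d) * (k - 1))) * emeasure (lambda_k k) (region 1)"
    using emeasure_PiM_lborel_scaleR_vimage[of "{2..k}" t "region t"] region_scale[OF \<open>t > 0\<close>]
      region_measurable[of t] \<open>t > 0\<close>
    by (simp add: lambda_k_def)
  then show ?thesis
    using \<open>t > 0\<close> by (simp add: measure_def enn2real_mult)
qed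

lemma noise_integral_eq_fdd_brownian:
  fixes c :: real and W :: "(nat \<Rightarrow> real ^ 'd) set \<Rightarrow> 'p \<Rightarrow> real"
  defines "\<mu> \<equiv> scale_measure (ennreal c) (lambda_k k)"
  assumes "c \<ge> 0" and "gaussian_noise P \<mu> W" and "standard_brownian_motion N B"
  shows "eq_fdd {0..} P (\<lambda>t. noise_integral P \<mu> W (\<lambda>y. of_bool (Q t (y(1 := 0)))))
    N (\<lambda>t. B (c * (\<integral>y. of_bool (Q 1 (y(1 := 0))) \<partial>lambda_k k) * t ^ (CARD('d) * (k - 1))))"
proof -
  interpret gaussian_noise P \<mu> W by fact
  interpret N: standard_brownian_motion N B by fact
  have space: "space \<mu> = space (lambda_k k)" by (simp add: \<mu>_def space_scale_measure)
  have fin: "region t \<in> finite_sets" if "t \<ge> 0" for t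
    using region_finite_measure[OF that] region_measurable[of t]
    unfolding finite_sets_def by (auto simp: \<mu>_def ennreal_mult_less_top)
  have ind: "(of_bool (Q t (y(1 := 0))) :: real) = indicator (region t) y" if "y \<in> space \<mu>" for t y
    using that by (simp add: region_def indicator_def space)
  have "(\<integral>y. (of_bool (Q 1 (y(1 := 0))) :: real) \<partial>lambda_k k) = (\<integral>y. indicator (region 1) y \<partial>lambda_k k)"
    using ind by (intro Bochner_Integration.integral_cong) (simp_all add: space)
  also have "\<dots> = measure (lambda_k k) (region 1)"
    using sets.sets_into_space[OF region_measurable[of 1]] by (simp add: Int_absorb2)
  finally have int: "(\<integral>y. of_bool (Q 1 (y(1 := 0))) \<partial>lambda_k k) = measure (lambda_k k) (region 1)" .
  have fdd: "eq_fdd {0..} P (\<lambda>t. W (region t))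
      N (\<lambda>t. B (c * measure (lambda_k k) (region 1) * t ^ (CARD('d) * (k - 1))))"
  proof (rule noise_of_growing_sets_eq_fdd)
    show "measure \<mu> (region t) = c * measure (lambda_k k) (region 1) * t ^ (CARD('d) * (k - 1))"
      if "t \<ge> 0" for t
      using measure_region[OF that] \<open>c \<ge> 0\<close> by (simp add: \<mu>_def)
  qed (use fin region_mono k \<open>c \<ge> 0\<close> \<open>standard_brownian_motion N B\<close> in auto)
  show ?thesis
    unfolding int
  proof (rule eq_fdd_cong_AE[OF fdd])
    fix t :: real assume t: "t \<in> {0..}"
    show "noise_integral P \<mu> W (\<lambda>y. of_bool (Q t (y(1 := 0)))) \<in> borel_measurable P"
      and "AE \<omega> in P. noise_integral P \<mu> W (\<lambda>y. of_bool (Q t (y(1 := 0)))) \<omega> = W (region t) \<omega>"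
      using noise_integral_indicator[OF fin ind] t by auto
    show "B (c * measure (lambda_k k) (region 1) * t ^ (CARD('d) * (k - 1))) \<in> borel_measurable N"
      using fdd t by (auto simp: eq_fdd_def)
  qed auto
qed

end

section \<open>The two families of configurations\<close>

definition dense_connected :: "nat \<Rightarrow> nat \<Rightarrow> real \<Rightarrow> (nat \<Rightarrow> 'a::metric_space) \<Rightarrow> bool" where
  "dense_connected k j t x \<longleftrightarrow> inj_on x {1..k} \<and>
     Digraph_Component.connected (with_proj (geometric_graph (x ` {1..k}) t)) \<and>
     num_edges (geometric_graph (x ` {1..k}) t) > j"

definition iso_or_dense_connected ::
    "'v pair_pre_digraph \<Rightarrow> nat \<Rightarrow> nat \<Rightarrow> real \<Rightarrow> (nat \<Rightarrow> 'a::metric_space) \<Rightarrow> bool" where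
  "iso_or_dense_connected \<Gamma> k j t x \<longleftrightarrow>
     digraph_iso (with_proj (geometric_graph (x ` {1..k}) t)) (with_proj \<Gamma>) \<or> dense_connected k j t x"

lemma card_image_eq_iff_inj_on: "card (x ` {1..k::nat}) = k \<longleftrightarrow> inj_on x {1..k}"
  by (simp add: inj_on_iff_eq_card)

lemma h_minus_eq: "h_minus k j t x = of_bool (dense_connected k j t x)"
  using card_image_eq_iff_inj_on[of x k] by (auto simp: h_minus_def dense_connected_def Let_def)

text \<open>
  The two summands of \<open>h\<^sup>+\<close> are never \<open>1\<close> together, since a graph isomorphic to \<open>\<Gamma>\<close> has exactly \<open>j\<close> edges.
\<close>

lemma h_plus_eq:
  assumes "num_edges \<Gamma> = j"
  shows "h_plus \<Gamma> k j t x = of_bool (iso_or_dense_connected \<Gamma> k j t x)"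
proof -
  let ?G = "geometric_graph (x ` {1..k}) t"
  have "num_edges ?G = j" if "digraph_iso (with_proj ?G) (with_proj \<Gamma>)"
    using digraph_iso_num_edges[OF that wf_geometric_graph] assms by simp
  then have "\<not> (digraph_iso (with_proj ?G) (with_proj \<Gamma>) \<and> dense_connected k j t x)"
    by (auto simp: dense_connected_def)
  then show ?thesis
    by (auto simp: h_plus_def h_iso_def h_minus_eq iso_or_dense_connected_def)
qed

lemma dense_connected_invariant:
  assumes "inj_on x {1..k}" "inj_on x' {1..k}"
    and "\<And>i j. i \<in> {1..k} \<Longrightarrow> j \<in> {1..k} \<Longrightarrow> dist (x i) (x j) \<le> t \<longleftrightarrow> dist (x' i) (x' j) \<le> t'"
    and "dense_connected k j t x"
  shows "dense_connected k j t' x'"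
proof -
  have iso: "digraph_iso (with_proj (geometric_graph (x ` {1..k}) t))
      (with_proj (geometric_graph (x' ` {1..k}) t'))"
    using assms(1-3) by (rule digraph_iso_geometric_graph)
  show ?thesis
    using assms digraph_iso_connected[OF iso wf_geometric_graph]
      digraph_iso_num_edges[OF iso wf_geometric_graph]
    by (simp add: dense_connected_def)
qed

lemma dense_connected_mono:
  assumes "s \<le> t" "dense_connected k j s x"
  shows "dense_connected k j t x"
  using assms connected_geometric_graph_mono[of "x ` {1..k}" s t]
    num_edges_geometric_graph_mono[of "x ` {1..k}" s t]
  by (auto simp: dense_connected_def)

lemma connected_graph_property_dense_connected:
  assumes "k \<ge> 2"
  shows "connected_graph_property k
    (dense_connected k j :: real \<Rightarrow> (nat \<Rightarrow> real ^ 'd::finite) \<Rightarrow> bool)"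
proof
  show "k \<ge> 2" by fact
next
  fix t t' and x x' :: "nat \<Rightarrow> real ^ 'd"
  assume "inj_on x {1..k}" "inj_on x' {1..k}"
    "\<And>i j. i \<in> {1..k} \<Longrightarrow> j \<in> {1..k} \<Longrightarrow> dist (x i) (x j) \<le> t \<longleftrightarrow> dist (x' i) (x' j) \<le> t'"
    "dense_connected k j t x"
  then show "dense_connected k j t' x'" by (rule dense_connected_invariant)
next
  fix s t and x :: "nat \<Rightarrow> real ^ 'd"
  assume "s \<le> t" "dense_connected k j s x"
  then show "dense_connected k j t x" by (rule dense_connected_mono)
qed (auto simp: dense_connected_def)

text \<open>
  The reason for working with \<open>h\<^sup>+\<close> rather than with the indicator of \<open>\<Gamma>\<close> alone is monotonicity in the
  scale: as the scale grows, a copy of \<open>\<Gamma>\<close> either does not change, or gains an edge and is from then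
  on connected with more than \<open>j\<close> edges.
\<close>

lemma connected_graph_property_iso_or_dense_connected:
  assumes "k \<ge> 2" and "pair_graph \<Gamma>" and conn: "Digraph_Component.connected (with_proj \<Gamma>)"
    and "card (pverts \<Gamma>) = k" "num_edges \<Gamma> = j"
  shows "connected_graph_property k
    (iso_or_dense_connected \<Gamma> k j :: real \<Rightarrow> (nat \<Rightarrow> real ^ 'd::finite) \<Rightarrow> bool)"
proof -
  interpret \<Gamma>: pair_graph \<Gamma> by fact
  have \<Gamma>: "wf_digraph (with_proj \<Gamma>)" by unfold_locales
  have iso: "inj_on x {1..k}" "Digraph_Component.connected (with_proj (geometric_graph (x ` {1..k}) t))"
    "num_edges (geometric_graph (x ` {1..k}) t) = j"
    if iso: "digraph_iso (with_proj (geometric_graph (x ` {1..k}) t)) (with_proj \<Gamma>)"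
    for t and x :: "nat \<Rightarrow> real ^ 'd"
  proof -
    show "inj_on x {1..k}"
      using digraph_iso_card_verts[OF iso] assms card_image_eq_iff_inj_on[of x k] by auto
    show "Digraph_Component.connected (with_proj (geometric_graph (x ` {1..k}) t))"
      using digraph_iso_swap[OF wf_geometric_graph iso] \<Gamma> conn by (rule digraph_iso_connected)
    show "num_edges (geometric_graph (x ` {1..k}) t) = j"
      using digraph_iso_num_edges[OF iso wf_geometric_graph] assms by simp
  qed
  show ?thesis
  proof
    show "k \<ge> 2" by fact
  next
    fix t and x :: "nat \<Rightarrow> real ^ 'd"
    assume "iso_or_dense_connected \<Gamma> k j t x"
    then show "inj_on x {1..k}"
      and "Digraph_Component.connected (with_proj (geometric_graph (x ` {1..k}) t))"
      using iso by (auto simp: iso_or_dense_connected_def dense_connected_def)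
  next
    fix t t' and x x' :: "nat \<Rightarrow> real ^ 'd"
    assume inv: "inj_on x {1..k}" "inj_on x' {1..k}"
      "\<And>i j. i \<in> {1..k} \<Longrightarrow> j \<in> {1..k} \<Longrightarrow> dist (x i) (x j) \<le> t \<longleftrightarrow> dist (x' i) (x' j) \<le> t'"
    have "digraph_iso (with_proj (geometric_graph (x' ` {1..k}) t'))
        (with_proj (geometric_graph (x ` {1..k}) t))"
      using inv by (intro digraph_iso_geometric_graph) auto
    moreover assume "iso_or_dense_connected \<Gamma> k j t x"
    ultimately show "iso_or_dense_connected \<Gamma> k j t' x'"
      using dense_connected_invariant[OF inv] by (auto simp: iso_or_dense_connected_def intro: digraph_iso_trans)
  next
    fix s t and x :: "nat \<Rightarrow> real ^ 'd"
    assume "s \<le> t" and "iso_or_dense_connected \<Gamma> k j s x"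
    then consider (iso) "digraph_iso (with_proj (geometric_graph (x ` {1..k}) s)) (with_proj \<Gamma>)"
      | (dense) "dense_connected k j s x"
      by (auto simp: iso_or_dense_connected_def)
    then show "iso_or_dense_connected \<Gamma> k j t x"
    proof cases
      case iso': iso
      show ?thesis
      proof (cases "num_edges (geometric_graph (x ` {1..k}) t) > j")
        case True
        then show ?thesis
          using iso[OF iso'] connected_geometric_graph_mono[OF _ \<open>s \<le> t\<close>]
          by (auto simp: iso_or_dense_connected_def dense_connected_def)
      next
        case False
        then have "geometric_graph (x ` {1..k}) s = geometric_graph (x ` {1..k}) t"
          using iso(3)[OF iso'] num_edges_geometric_graph_mono[of "x ` {1..k}", OF _ \<open>s \<le> t\<close>] \<open>s \<le> t\<close>
          by (intro geometric_graph_eqI_num_edges) (auto intro: antisym)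
        then show ?thesis using iso' by (simp add: iso_or_dense_connected_def)
      qed
    qed (use dense_connected_mono[OF \<open>s \<le> t\<close>] in \<open>auto simp: iso_or_dense_connected_def\<close>)
  qed
qed

lemma B_const_nonneg:
  assumes "k \<ge> 2" "\<alpha> > real CARD('d::finite)"
  shows "B_const TYPE('d) \<alpha> k \<ge> 0"
proof -
  have "real CARD('d) \<le> \<alpha> * real k"
    using assms mult_mono[of "real CARD('d)" \<alpha> 1 "real k"] by simp
  moreover have "surface_area (sphere (0 :: real ^ 'd) 1) \<ge> 0"
    unfolding surface_area_unit_sphere by (intro divide_nonneg_nonneg Gamma_real_nonneg) auto
  ultimately show ?thesis by (simp add: B_const_def)
qed

theorem proposition4p1:
  fixes \<Gamma> :: "'v pair_pre_digraph" and k j :: nat and \<alpha> :: real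
    and P :: "'p measure" and W :: "(nat \<Rightarrow> real ^ 'd::finite) set \<Rightarrow> 'p \<Rightarrow> real"
    and N :: "'q measure" and B :: "real \<Rightarrow> 'q \<Rightarrow> real"
  assumes "k \<ge> 2" and "\<alpha> > real CARD('d)"
    and "pair_graph \<Gamma>" and "Digraph_Component.connected (with_proj \<Gamma>)"
    and "card (pverts \<Gamma>) = k" and "num_edges \<Gamma> = j"
    and "gaussian_noise P (noise_control \<alpha> k) W"
    and "standard_brownian_motion N B"
  shows "eq_fdd {0..} P (V_plus P W \<alpha> \<Gamma> k j)
           N (\<lambda>t. B (K_plus TYPE('d) \<alpha> \<Gamma> k j * t ^ (CARD('d) * (k - 1)))) \<and>
         eq_fdd {0..} P (V_minus P W \<alpha> k j)
           N (\<lambda>t. B (K_minus TYPE('d) \<alpha> k j * t ^ (CARD('d) * (k - 1))))"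
proof -
  interpret plus: connected_graph_property k
    "iso_or_dense_connected \<Gamma> k j :: real \<Rightarrow> (nat \<Rightarrow> real ^ 'd) \<Rightarrow> bool"
    using assms(1,3-6) by (rule connected_graph_property_iso_or_dense_connected)
  interpret minus: connected_graph_property k
    "dense_connected k j :: real \<Rightarrow> (nat \<Rightarrow> real ^ 'd) \<Rightarrow> bool"
    using assms(1) by (rule connected_graph_property_dense_connected)
  note c = B_const_nonneg[OF assms(1,2)]
  note noise = assms(7)[unfolded noise_control_def]
  have "V_plus P W \<alpha> \<Gamma> k j = (\<lambda>t. noise_integral P (noise_control \<alpha> k) W
      (\<lambda>y. of_bool (iso_or_dense_connected \<Gamma> k j t (y(1 := 0)))))"
    by (simp add: fun_eq_iff V_plus_def h_plus_eq[OF assms(6)])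
  moreover have "V_minus P W \<alpha> k j = (\<lambda>t. noise_integral P (noise_control \<alpha> k) W
      (\<lambda>y. of_bool (dense_connected k j t (y(1 := 0)))))"
    by (simp add: fun_eq_iff V_minus_def h_minus_eq)
  ultimately show ?thesis
    using plus.noise_integral_eq_fdd_brownian[OF c noise assms(8)]
      minus.noise_integral_eq_fdd_brownian[OF c noise assms(8)]
    by (simp add: K_plus_def K_minus_def h_plus_eq[OF assms(6)] h_minus_eq noise_control_def)
qed

end
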